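(* Let $\rho$ be an even positive Borel measure on $\mathbb{R}$ with $0<\rho(\mathbb{R})<\infty$ such that $\int_{-\infty}^{\infty} e^{bt^2}\,d\rho(t)<\infty$ for every $b\in\mathbb{R}$ (i.e. $\mathcal{T}_\rho=(-\infty,\infty)$). Suppose there exist sequences $b_n>0$ with $b_n\to\infty$ and $r_n>0$ such that the probability measures $$K_n\, e^{b_n t^2}\,d\rho(t)\big|_{t=r_n u}$$ (in the variable $u$) converge weakly as $n\to\infty$ to a probability measure $\mu$ with $\mu\notin\mathcal{X}$, where $K_n$ is the constant making the displayed measure a probability measure. Then $\mathcal{P}_\rho=\emptyset$.
   Context: For an even positive finite Borel measure $\rho$ on $\mathbb{R}$ and $\lambda\in\mathbb{R}$, let $H_{\rho,\lambda}(z)=\int_{-\infty}^{\infty} e^{izt}e^{\lambda t^2}\,d\rho(t)$ for $z\in\mathbb{C}$. Define $\mathcal{T}_\rho=\{b\in\mathbb{R}:\int e^{bx^2}\,d\rho(x)<\infty\}$ and $\mathcal{P}_\rho=\{\lambda\in\mathbb{R}: H_{\rho,\lambda}\text{ is entire and all its zeros in }\mathbb{C}\text{ are real}\}$. The notation $K_n e^{b_nt^2}d\rho(t)|_{t=r_nu}$ means the distribution of $u=t/r_n$ when $t$ is distributed according to the normalized measure $K_n e^{b_nt^2}\,d\rho(t)$; that is, the push-forward of $K_n e^{b_nt^2}\,d\rho(t)$ under $t\mapsto t/r_n$, with $K_n=\left(\int e^{b_nt^2}\,d\rho(t)\right)^{-1}$. $\mathcal{X}$ is the set of probability measures $\mu$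 on $\mathbb{R}$ such that, for a random variable $X$ with distribution $\mu$: (1) $X$ has the same distribution as $-X$; (2) $\mathbb{E}[\exp(bX^2)]<\infty$ for some $b>0$; (3) the function $z\mapsto\mathbb{E}[\exp(izX)]$, $z\in\mathbb{C}$, has only real zeros. *)

theory Defs
  imports "HOL-Probability.Probability" "HOL-Complex_Analysis.Complex_Analysis"
begin

definition even_measure :: "real measure \<Rightarrow> bool" where
  "even_measure M \<longleftrightarrow> distr M borel uminus = M"

definition H :: "real measure \<Rightarrow> real \<Rightarrow> complex \<Rightarrow> complex" where
  "H \<rho> lam z = (LINT t|\<rho>. exp (\<i> * z * complex_of_real t) * complex_of_real (exp (lam * t\<^sup>2)))"

definition \<T> :: "real measure \<Rightarrow> real set" where
  "\<T> \<rho> = {b. (\<integral>\<^sup>+ x. ennreal (exp (b * x\<^sup>2)) \<partial>\<rho>) < \<infinity>}"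

(* The integral of a non-integrable function is 0 here, so "H is entire" is made to include
   the requirement that its defining integral converges for every complex z. *)
definition \<P> :: "real measure \<Rightarrow> real set" where
  "\<P> \<rho> = {lam.
     (\<forall>z. integrable \<rho> (\<lambda>t. exp (\<i> * z * complex_of_real t) * complex_of_real (exp (lam * t\<^sup>2)))) \<and>
     H \<rho> lam holomorphic_on UNIV \<and>
     (\<forall>z. H \<rho> lam z = 0 \<longrightarrow> z \<in> \<real>)}"

(* The last condition is about a convergent integral: the second one makes
   exp (i z x) integrable for every complex z. *)
definition \<X> :: "real measure set" where
  "\<X> = {\<mu>. real_distribution \<mu> \<and>
     even_measure \<mu> \<and>
     (\<exists>b>0. (\<integral>\<^sup>+ x. ennreal (exp (b * x\<^sup>2)) \<partial>\<mu>) < \<infinity>) \<and>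
     (\<forall>z. (LINT x|\<mu>. exp (\<i> * z * complex_of_real x)) = 0 \<longrightarrow> z \<in> \<real>)}"

definition tilt_const :: "real measure \<Rightarrow> real \<Rightarrow> real" where
  "tilt_const \<rho> b = inverse (LINT t|\<rho>. exp (b * t\<^sup>2))"

definition rescaled_tilt :: "real measure \<Rightarrow> real \<Rightarrow> real \<Rightarrow> real measure" where
  "rescaled_tilt \<rho> b r =
     distr (density \<rho> (\<lambda>t. ennreal (tilt_const \<rho> b * exp (b * t\<^sup>2)))) borel (\<lambda>t. t / r)"

end

theory Submission
  imports Defs "HOL-Real_Asymp.Real_Asymp"
begin

text \<open>
  Suppose \<^term>\<open>lam \<in> \<P> \<rho>\<close>. Since all Gaussian moments of \<^term>\<open>\<rho>\<close> are finite,
  the functions \<^term>\<open>H \<rho> b\<close> grow more slowly than every \<open>exp (e |z|^2)\<close>, so an even one with only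
  real zeros is a limit of products of factors \<open>1 - z^2 / y^2\<close> with real \<open>y\<close> (for the square of the
  function, which suffices). Such a limit has modulus increasing in \<open>|Im z|\<close>, whence averaging the
  shifts by \<open>i c\<close> and \<open>- i c\<close> preserves the reality of zeros; this multiplies the measure by \<open>cosh (c t)\<close>,
  and iterating gives the factor \<open>exp (s t^2)\<close> in the limit. So every \<^term>\<open>b \<ge> lam\<close> belongs
  to \<^term>\<open>\<P> \<rho>\<close>, and the rescaled measures belong to \<^term>\<open>\<X>\<close> from some index on.

  The product form also bounds \<open>f (i s)\<close> by \<open>f d\<close> to the power \<open>- s^2 / d^2\<close> if \<open>f 0 = 1\<close> and \<open>f\<close> has
  no zeros on \<open>[-d, d]\<close>. Weak convergence keeps the characteristic functions above \<open>1/2\<close> on one such interval,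
  so the rescaled measures are uniformly sub-Gaussian. Hence the limit is sub-Gaussian, the entire
  characteristic functions form a normal family, and Hurwitz's theorem puts the limit in \<^term>\<open>\<X>\<close>.
\<close>

section \<open>Product approximation of even entire functions with real zeros\<close>

lemma norm_prod_list_factors_ge:
  fixes ys :: "complex list"
  assumes "\<And>y. y \<in> set ys \<Longrightarrow> y \<noteq> 0 \<and> norm y \<le> R" and "norm z = 3 * R"
  shows "2 ^ length ys \<le> norm (\<Prod>y\<leftarrow>ys. (1 - z / y))"
  using assms(1)
proof (induction ys)
  case (Cons y ys)
  have y: "0 < norm y" "norm y \<le> R" using Cons.prems by auto
  have "3 \<le> norm (z / y)"
    using y assms(2) by (simp add: norm_divide field_simps)
  then have "2 \<le> norm (1 - z / y)"
    using norm_triangle_ineq2[of "z / y" 1] by (simp add: norm_minus_commute)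
  with Cons show ?case
    by (auto simp: norm_mult intro!: mult_mono)
qed simp

text \<open>By the maximum modulus principle it is enough to look at the circle of radius
  \<open>3 * R\<close>, where every linear factor has modulus at least 2. At \<open>z = 0\<close>
  the estimate limits the number of zeros; elsewhere it bounds the cofactor independently of
  \<open>ys\<close>.\<close>

lemma norm_cofactor_le:
  fixes f g :: "complex \<Rightarrow> complex"
  assumes "R > 0" and g: "g holomorphic_on UNIV"
    and fg: "\<And>z. f z = (\<Prod>y\<leftarrow>ys. (1 - z / y)) * g z"
    and ys: "\<And>y. y \<in> set ys \<Longrightarrow> y \<noteq> 0 \<and> norm y \<le> R"
    and B: "\<And>z. norm z = 3 * R \<Longrightarrow> norm (f z) \<le> B"
    and z: "norm z \<le> 3 * R"
  shows "2 ^ length ys * norm (g z) \<le> B"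
proof -
  have "norm (g z) \<le> B / 2 ^ length ys"
  proof (rule maximum_modulus_frontier[of g "cball 0 (3 * R)"])
    show "g holomorphic_on interior (cball 0 (3 * R))"
      using g holomorphic_on_subset by blast
    show "continuous_on (closure (cball 0 (3 * R))) g"
      using g holomorphic_on_imp_continuous_on holomorphic_on_subset by blast
    show "norm (g w) \<le> B / 2 ^ length ys" if "w \<in> frontier (cball 0 (3 * R))" for w
    proof -
      have w: "norm w = 3 * R"
        using that \<open>R > 0\<close> by (auto simp: frontier_cball)
      have "2 ^ length ys * norm (g w) \<le> norm (\<Prod>y\<leftarrow>ys. (1 - w / y)) * norm (g w)"
        by (intro mult_right_mono norm_prod_list_factors_ge[OF ys w]) auto
      also have "\<dots> \<le> B"
        using B[OF w] by (simp add: fg norm_mult)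
      finally show ?thesis by (simp add: field_simps)
    qed
  qed (use z in auto)
  then show ?thesis by (simp add: field_simps)
qed

lemma entire_factorization_cball:
  fixes f :: "complex \<Rightarrow> complex"
  assumes f: "f holomorphic_on UNIV" and f0: "f 0 = 1" and "R > 0"
  obtains ys g where "\<And>y. y \<in> set ys \<Longrightarrow> f y = 0 \<and> y \<noteq> 0 \<and> norm y \<le> R"
    and "g holomorphic_on UNIV" and "\<And>z. f z = (\<Prod>y\<leftarrow>ys. (1 - z / y)) * g z"
    and "\<And>z. norm z \<le> R \<Longrightarrow> g z \<noteq> 0"
proof -
  \<comment> \<open>Each factor has modulus at least 2 on the circle of radius \<open>3 R\<close>, which bounds the number of
    zeros that can be split off; a longest list leaves no zero in the disc.\<close>
  define P where "P ys g \<longleftrightarrow> (\<forall>y\<in>set ys. f y = 0 \<and> y \<noteq> 0 \<and> norm y \<le> R) \<and> g holomorphic_on UNIV \<and>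
      (\<forall>z. f z = (\<Prod>y\<leftarrow>ys. (1 - z / y)) * g z)" for ys g
  have "compact (f ` sphere 0 (3 * R))"
    using f by (intro compact_continuous_image)
      (auto intro: holomorphic_on_imp_continuous_on holomorphic_on_subset)
  then obtain B where B: "\<And>z. norm z = 3 * R \<Longrightarrow> norm (f z) \<le> B"
    using compact_imp_bounded bounded_iff by (metis imageI mem_sphere_0)
  have len: "length ys \<le> nat \<lceil>B\<rceil>" if "P ys g" for ys g
  proof -
    have "2 ^ length ys * norm (g 0) \<le> B"
    proof (rule norm_cofactor_le[where f = f and g = g and z = 0, OF \<open>R > 0\<close>])
      show "g holomorphic_on UNIV" using that by (simp add: P_def)
      show "f z = (\<Prod>y\<leftarrow>ys. (1 - z / y)) * g z" for z using that unfolding P_def by blast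
      show "y \<noteq> 0 \<and> norm y \<le> R" if "y \<in> set ys" for y
        using that \<open>P ys g\<close> unfolding P_def by blast
    qed (use B \<open>R > 0\<close> in auto)
    moreover have "g 0 = 1"
    proof -
      have "(\<Prod>y\<leftarrow>ys. (1 - 0 / y)) = (1::complex)" by (induction ys) auto
      then show ?thesis using that f0 unfolding P_def by (metis mult_1)
    qed
    ultimately have "2 ^ length ys \<le> B" by simp
    then show ?thesis
      using of_nat_less_two_power[of "length ys", where 'a=real] by linarith
  qed
  have "P [] f" using f by (auto simp: P_def)
  then have "\<exists>x. (case x of (ys, g) \<Rightarrow> P ys g) \<and> (\<forall>y. (case y of (ys, g) \<Rightarrow> P ys g) \<longrightarrow> length (fst y) \<le> length (fst x))"
    using len by (intro ex_has_greatest_nat[of _ "([], f)" _ "Suc (nat \<lceil>B\<rceil>)"]) (auto simp: less_Suc_eq_le)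
  then obtain ys g where P: "P ys g" and max: "\<And>zs h. P zs h \<Longrightarrow> length zs \<le> length ys"
    by auto
  have "g z \<noteq> 0" if z: "norm z \<le> R" for z
  proof
    assume gz: "g z = 0"
    define h where "h = (\<lambda>w. if w = z then deriv g z else (g w - g z) / (w - z))"
    have h: "h holomorphic_on UNIV"
      unfolding h_def using P by (intro pole_lemma_open) (auto simp: P_def)
    have fz: "f z = 0" using P gz by (auto simp: P_def)
    then have z0: "z \<noteq> 0" using f0 by auto
    \<comment> \<open>The factor \<open>w - z\<close> is rewritten as
      \<open>- z * (1 - w / z)\<close>, so that all linear factors are normalised to 1 at the
      origin.\<close>
    have "g w = (1 - w / z) * (- z * h w)" for w
      using gz z0 by (auto simp: h_def field_simps)
    then have "f w = (\<Prod>y\<leftarrow>z # ys. (1 - w / y)) * (- z * h w)" for w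
      using P by (simp add: P_def mult_ac)
    then have "P (z # ys) (\<lambda>w. - z * h w)"
      using P h z fz z0 unfolding P_def by (auto intro!: holomorphic_intros)
    from max[OF this] show False by simp
  qed
  then show ?thesis using P that unfolding P_def by blast
qed

section \<open>Schwarz and Borel-Caratheodory estimates for even functions\<close>

lemma deriv_even_0:
  fixes f :: "complex \<Rightarrow> complex"
  assumes f: "f holomorphic_on ball 0 r" and "r > 0" and even: "\<And>z. norm z < r \<Longrightarrow> f (- z) = f z"
  shows "deriv f 0 = 0"
proof -
  have d: "(f has_field_derivative deriv f 0) (at 0)"
    using f \<open>r > 0\<close> by (intro holomorphic_derivI[of f "ball 0 r"]) auto
  then have "((\<lambda>z. f (- z)) has_field_derivative - deriv f 0) (at 0)"
    using DERIV_chain2[of f "deriv f 0" uminus 0 "-1" UNIV] by (simp add: DERIV_minus[OF DERIV_ident])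
  then have "(f has_field_derivative - deriv f 0) (at 0)"
    by (rule has_field_derivative_transform_within_open[of _ _ _ "ball 0 r"]) (use even \<open>r > 0\<close> in auto)
  with d have "deriv f 0 = - deriv f 0" by (rule DERIV_unique)
  then show ?thesis by simp
qed

text \<open>Evenness kills the derivative at 0, so the quotient \<open>h = f z / z\<close> vanishes
  at 0 as well, and the Schwarz lemma can be applied a second time, to \<open>h\<close>.\<close>

lemma Schwarz_Lemma_even:
  fixes f :: "complex \<Rightarrow> complex"
  assumes f: "f holomorphic_on ball 0 1" and f0: "f 0 = 0"
    and no: "\<And>z. norm z < 1 \<Longrightarrow> norm (f z) < 1"
    and even: "\<And>z. norm z < 1 \<Longrightarrow> f (- z) = f z" and z: "norm z < 1"
  shows "norm (f z) \<le> (norm z)\<^sup>2"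
proof -
  obtain h where h: "h holomorphic_on ball 0 1" and fh: "\<And>z. norm z < 1 \<Longrightarrow> f z = z * h z"
    and h0: "deriv f 0 = h 0"
    using Schwarz3[OF f f0] by blast
  have h0: "h 0 = 0" using h0 deriv_even_0[OF f _ even] by simp
  have nh: "norm (h w) \<le> 1" if "norm w < 1" for w
    using Schwarz_Lemma(1)[OF f f0 no that] fh[OF that] h0
    by (cases "w = 0") (auto simp: norm_mult)
  \<comment> \<open>Only \<open>norm (h w) \<le> 1\<close> is known, while the Schwarz lemma asks
    for a strict bound; scaling by \<open>c < 1\<close> supplies it, and \<open>c\<close> then tends
    to 1.\<close>
  have "c * norm (h z) \<le> norm z" if c: "0 < c" "c < 1" for c
  proof -
    have "norm (complex_of_real c * h z) \<le> norm z"
    proof (rule Schwarz_Lemma(1))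
      show "norm (complex_of_real c * h w) < 1" if "norm w < 1" for w
      proof -
        have "c * norm (h w) \<le> c" using nh[OF that] c by simp
        also have "\<dots> < 1" using c by simp
        finally show ?thesis using c by (simp add: norm_mult)
      qed
    qed (use h h0 z in \<open>auto intro!: holomorphic_intros\<close>)
    with c show ?thesis by (simp add: norm_mult)
  qed
  then have "norm (h z) \<le> norm z"
    by (rule field_le_mult_one_interval)
  then show ?thesis
    using fh[OF z] by (auto simp: norm_mult power2_eq_square intro: mult_left_mono)
qed

text \<open>The classical argument with the even Schwarz lemma in place of the usual one. The gain
  is the quadratic factor \<open>(norm z)\<^sup>2 / R\<^sup>2\<close>, which matches a bound
  \<open>A\<close> that grows like a small multiple of \<open>R\<^sup>2\<close>.\<close>

lemma Borel_Caratheodory_even: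
  fixes L :: "complex \<Rightarrow> complex"
  assumes L: "L holomorphic_on ball 0 R" and "R > 0" and L0: "L 0 = 0"
    and even: "\<And>z. norm z < R \<Longrightarrow> L (- z) = L z"
    and Re: "\<And>z. norm z < R \<Longrightarrow> Re (L z) < A" and z: "2 * (norm z)\<^sup>2 \<le> R\<^sup>2"
  shows "norm (L z) \<le> 4 * A * (norm z)\<^sup>2 / R\<^sup>2"
proof -
  have A: "A > 0" using Re[of 0] L0 \<open>R > 0\<close> by simp
  \<comment> \<open>The half plane \<open>Re w < A\<close> is mapped into the unit disc, fixing 0.\<close>
  define p where "p w = L w / (2 * A - L w)" for w
  have ne: "2 * A - L w \<noteq> 0" if "norm w < R" for w
  proof
    assume "2 * A - L w = 0"
    then have "Re (L w) = 2 * A" by (simp add: complex_eq_iff)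
    with Re[OF that] A show False by simp
  qed
  have np: "norm (p w) < 1" if "norm w < R" for w
  proof -
    have "(norm (L w))\<^sup>2 < (norm (2 * A - L w))\<^sup>2"
      using Re[OF that] A mult_strict_left_mono[of "Re (L w)" A "4 * A"]
      by (simp add: cmod_power2) (simp add: power2_eq_square algebra_simps)
    then have "norm (L w) < norm (2 * A - L w)"
      by (rule power_less_imp_less_base) auto
    then show ?thesis using ne[OF that] by (simp add: p_def norm_divide)
  qed
  have zR: "norm z < R"
  proof -
    have "(norm z)\<^sup>2 < R\<^sup>2" using z \<open>R > 0\<close> by (smt (verit) zero_less_power2 zero_le_power2)
    then show ?thesis using \<open>R > 0\<close> by (simp add: power_less_imp_less_base)
  qed
  define x where "x = (norm z)\<^sup>2 / R\<^sup>2"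
  have x: "x \<le> 1 / 2" using z \<open>R > 0\<close> by (simp add: x_def field_simps)
  have px: "norm (p z) \<le> x"
  proof -
    have "norm (p (R * (z / R))) \<le> (norm (z / R))\<^sup>2"
    proof (rule Schwarz_Lemma_even[where f = "\<lambda>w. p (R * w)" and z = "z / R"])
      have "p holomorphic_on ball 0 R"
        unfolding p_def using L ne by (intro holomorphic_intros) auto
      then show "(\<lambda>w. p (R * w)) holomorphic_on ball 0 1"
        using \<open>R > 0\<close> by (intro holomorphic_on_compose_gen[of "\<lambda>w. R * w" _ p "ball 0 R", unfolded o_def])
          (auto intro!: holomorphic_intros simp: norm_mult)
      show "norm (p (R * w)) < 1" if "norm w < 1" for w :: complex
        using that \<open>R > 0\<close> by (intro np) (simp add: norm_mult)
      show "p (R * - w) = p (R * w)" if "norm w < 1" for w :: complex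
        using even[of "R * w"] that \<open>R > 0\<close> by (simp add: p_def norm_mult)
    qed (use L0 zR \<open>R > 0\<close> in \<open>auto simp: p_def norm_divide\<close>)
    then show ?thesis using \<open>R > 0\<close> by (simp add: x_def norm_divide power_divide)
  qed
  \<comment> \<open>Inverting the Moebius map gives \<open>L = 2 A p / (1 + p)\<close>; since
    \<open>norm (p z) \<le> 1 / 2\<close>, the denominator has modulus at least 1/2.\<close>
  have "L z * (1 + p z) = 2 * A * p z"
    unfolding p_def using ne[OF zR] by (simp add: divide_simps)
  then have "norm (L z * (1 + p z)) = norm (2 * A * p z)" by (rule arg_cong)
  then have *: "norm (L z) * norm (1 + p z) = 2 * A * norm (p z)"
    using A by (simp add: norm_mult)
  have "1 / 2 \<le> norm (1 + p z)"
    using norm_triangle_ineq2[of 1 "- p z"] px x by simp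
  then have "norm (L z) * (1 / 2) \<le> norm (L z) * norm (1 + p z)"
    by (rule mult_left_mono) simp
  also have "\<dots> \<le> 2 * A * x"
    unfolding * using px A by (intro mult_left_mono) auto
  finally show ?thesis by (simp add: x_def)
qed

text \<open>
  The zeros need not be paired here: passing to \<open>f z * f (- z)\<close> symmetrises the logarithm of the
  zero-free cofactor, so its linear term drops out and its error is \<open>A |z|^2 / R^2\<close> rather than \<open>A |z| / R\<close>.
\<close>

lemma even_entire_square_factorization:
  fixes f :: "complex \<Rightarrow> complex"
  assumes f: "f holomorphic_on UNIV" and f0: "f 0 = 1" and even: "\<And>z. f (- z) = f z"
    and real: "\<And>z. f z = 0 \<Longrightarrow> z \<in> \<real>" and "R > 0"
  obtains ys L where "\<And>y. y \<in> set ys \<Longrightarrow> f (complex_of_real y) = 0"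
    and "\<And>z. norm z < R \<Longrightarrow> (f z)\<^sup>2 = (\<Prod>y\<leftarrow>ys. (1 - z\<^sup>2 / (complex_of_real y)\<^sup>2)) * exp (L z)"
    and "\<And>A z. (\<And>w. norm w = 3 * R \<Longrightarrow> norm (f w) \<le> exp A) \<Longrightarrow> 2 * (norm z)\<^sup>2 \<le> R\<^sup>2 \<Longrightarrow>
           norm (L z) \<le> 4 * (2 * A + 1) * (norm z)\<^sup>2 / R\<^sup>2"
proof -
  obtain ys g where ys: "\<And>y. y \<in> set ys \<Longrightarrow> f y = 0 \<and> y \<noteq> 0 \<and> norm y \<le> R"
    and g: "g holomorphic_on UNIV" and fg: "\<And>z. f z = (\<Prod>y\<leftarrow>ys. (1 - z / y)) * g z"
    and g0: "\<And>z. norm z \<le> R \<Longrightarrow> g z \<noteq> 0"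
    using entire_factorization_cball[OF f f0 \<open>R > 0\<close>] by blast
  obtain l where l: "l holomorphic_on ball 0 R" and gl: "\<And>z. z \<in> ball 0 R \<Longrightarrow> exp (l z) = g z"
  proof (rule holomorphic_logarithm_exists[of "ball 0 R" g 0])
    show "g holomorphic_on ball 0 R" using g holomorphic_on_subset by blast
    show "\<And>x. x \<in> ball 0 R \<Longrightarrow> g x \<noteq> 0" using g0 by auto
  qed (use \<open>R > 0\<close> in auto)
  \<comment> \<open>This is a logarithm of \<open>g z * g (- z)\<close>. Subtracting
    \<open>l 0\<close>, whose exponential is 1, makes \<open>L 0 = 0\<close> without changing
    \<open>exp (L z)\<close>.\<close>
  define L where "L z = (l z - l 0) + (l (- z) - l 0)" for z
  have "g 0 = 1"
  proof -
    have "(\<Prod>y\<leftarrow>ys. (1 - 0 / y)) = (1::complex)" by (induction ys) auto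
    then show ?thesis using fg[of 0] f0 by simp
  qed
  then have el0: "exp (l 0) = 1" using gl[of 0] \<open>R > 0\<close> by simp
  have expL: "exp (L z) = g z * g (- z)" if "norm z < R" for z
    using gl[of z] gl[of "- z"] that by (simp only: L_def exp_add exp_diff el0) simp
  have L: "L holomorphic_on ball 0 R"
  proof -
    have "(l \<circ> uminus) holomorphic_on ball 0 R"
      using l by (intro holomorphic_on_compose_gen[of uminus _ l "ball 0 R"]) (auto intro!: holomorphic_intros)
    with l show ?thesis unfolding L_def o_def by (intro holomorphic_intros) auto
  qed
  show thesis
  proof (rule that[of "map Re ys" L])
    have re: "complex_of_real (Re y) = y" if "y \<in> set ys" for y
      using real[of y] ys[OF that] by (simp add: of_real_Re)
    show "f (complex_of_real y) = 0" if "y \<in> set (map Re ys)" for y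
      using that ys re by auto
    show "(f z)\<^sup>2 = (\<Prod>y\<leftarrow>map Re ys. (1 - z\<^sup>2 / (complex_of_real y)\<^sup>2)) * exp (L z)" if zR: "norm z < R" for z
    proof -
      have "(\<Prod>y\<leftarrow>ys. (1 - z / y)) * (\<Prod>y\<leftarrow>ys. (1 - (- z) / y)) =
            (\<Prod>y\<leftarrow>map Re ys. (1 - z\<^sup>2 / (complex_of_real y)\<^sup>2))"
        using re
      proof (induction ys)
        case (Cons y ys)
        have "(1 - z / y) * (1 - (- z) / y) = 1 - z\<^sup>2 / (complex_of_real (Re y))\<^sup>2"
          using Cons.prems[of y] by (simp add: algebra_simps power2_eq_square)
        moreover have "(\<Prod>y\<leftarrow>y # ys. (1 - z / y)) * (\<Prod>y\<leftarrow>y # ys. (1 - (- z) / y)) =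
            ((1 - z / y) * (1 - (- z) / y)) * ((\<Prod>y\<leftarrow>ys. (1 - z / y)) * (\<Prod>y\<leftarrow>ys. (1 - (- z) / y)))"
          by (simp only: list.map prod_list.Cons mult_ac)
        moreover note Cons.IH[OF Cons.prems[OF list.set_intros(2)]]
        ultimately show ?case by (simp only: list.map prod_list.Cons)
      qed auto
      moreover have "(f z)\<^sup>2 = ((\<Prod>y\<leftarrow>ys. (1 - z / y)) * g z) * ((\<Prod>y\<leftarrow>ys. (1 - (- z) / y)) * g (- z))"
        using fg[of z] fg[of "- z"] even[of z] by (simp only: power2_eq_square)
      ultimately show ?thesis
        using expL[OF zR] by (simp only: mult_ac)
    qed
    show "norm (L z) \<le> 4 * (2 * A + 1) * (norm z)\<^sup>2 / R\<^sup>2"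
      if A: "\<And>w. norm w = 3 * R \<Longrightarrow> norm (f w) \<le> exp A" and z: "2 * (norm z)\<^sup>2 \<le> R\<^sup>2" for A z
    proof (rule Borel_Caratheodory_even[OF L \<open>R > 0\<close>])
      have ng: "norm (g w) \<le> exp A" if "norm w < R" for w
      proof -
        have "2 ^ length ys * norm (g w) \<le> exp A"
          using norm_cofactor_le[OF \<open>R > 0\<close> g fg _ A, of w] ys that \<open>R > 0\<close> by auto
        moreover have "1 * norm (g w) \<le> 2 ^ length ys * norm (g w)"
          by (intro mult_right_mono) auto
        ultimately show ?thesis by linarith
      qed
      \<comment> \<open>The bound obtained is \<open>2 * A\<close>; the added 1 makes it strict, as
        \<open>Borel_Caratheodory_even\<close> requires.\<close>
      show "Re (L w) < 2 * A + 1" if "norm w < R" for w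
      proof -
        have "exp (Re (L w)) = norm (g w) * norm (g (- w))"
          using expL[OF that] by (metis norm_exp_eq_Re norm_mult)
        also have "\<dots> \<le> exp A * exp A"
          using ng[of w] ng[of "- w"] that by (intro mult_mono) auto
        also have "\<dots> = exp (2 * A)" by (simp flip: exp_add)
        finally show ?thesis by simp
      qed
    qed (use z in \<open>auto simp: L_def\<close>)
  qed
qed

text \<open>The factorizations on discs of radius \<open>R = n + 1\<close> have errors
  \<open>L n z\<close> that tend to 0: inserting \<open>A = C + e * (3 * R)\<^sup>2\<close> into
  their bound leaves a term of order \<open>1 / R\<^sup>2\<close> and a fixed multiple of
  \<open>e\<close>, where \<open>e\<close> is arbitrarily small.\<close>

lemma even_entire_square_product_limit:
  fixes f :: "complex \<Rightarrow> complex"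
  assumes f: "f holomorphic_on UNIV" and f0: "f 0 = 1" and even: "\<And>z. f (- z) = f z"
    and real: "\<And>z. f z = 0 \<Longrightarrow> z \<in> \<real>"
    and growth: "\<And>e. e > 0 \<Longrightarrow> \<exists>C. \<forall>z. norm (f z) \<le> exp (C + e * (norm z)\<^sup>2)"
  obtains Y :: "nat \<Rightarrow> real list" where "\<And>n y. y \<in> set (Y n) \<Longrightarrow> f (complex_of_real y) = 0"
    and "\<And>z. (\<lambda>n. \<Prod>y\<leftarrow>Y n. (1 - z\<^sup>2 / (complex_of_real y)\<^sup>2)) \<longlonglongrightarrow> (f z)\<^sup>2"
proof -
  have "\<forall>n. \<exists>ys L. (\<forall>y\<in>set ys. f (complex_of_real y) = 0) \<and>
      (\<forall>z. norm z < real (Suc n) \<longrightarrow> (f z)\<^sup>2 = (\<Prod>y\<leftarrow>ys. (1 - z\<^sup>2 / (complex_of_real y)\<^sup>2)) * exp (L z)) \<and>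
      (\<forall>A z. (\<forall>w. norm w = 3 * real (Suc n) \<longrightarrow> norm (f w) \<le> exp A) \<longrightarrow> 2 * (norm z)\<^sup>2 \<le> (real (Suc n))\<^sup>2 \<longrightarrow>
           norm (L z) \<le> 4 * (2 * A + 1) * (norm z)\<^sup>2 / (real (Suc n))\<^sup>2)" (is "\<forall>n. ?P n")
  proof
    fix n show "?P n"
      using even_entire_square_factorization[OF f f0 even real, of "real (Suc n)"]
      by (smt (verit, ccfv_threshold) of_nat_0_less_iff zero_less_Suc)
  qed
  then obtain Y L where Y: "\<And>n y. y \<in> set (Y n) \<Longrightarrow> f (complex_of_real y) = 0"
    and YL: "\<And>n z. norm z < real (Suc n) \<Longrightarrow> (f z)\<^sup>2 = (\<Prod>y\<leftarrow>Y n. (1 - z\<^sup>2 / (complex_of_real y)\<^sup>2)) * exp (L n z)"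
    and Lb: "\<And>n A z. (\<And>w. norm w = 3 * real (Suc n) \<Longrightarrow> norm (f w) \<le> exp A) \<Longrightarrow> 2 * (norm z)\<^sup>2 \<le> (real (Suc n))\<^sup>2 \<Longrightarrow>
           norm (L n z) \<le> 4 * (2 * A + 1) * (norm z)\<^sup>2 / (real (Suc n))\<^sup>2"
    by metis
  show thesis
  proof (rule that[OF Y])
    fix z
    have "(\<lambda>n. L n z) \<longlonglongrightarrow> 0"
    proof (rule tendsto_norm_zero_cancel, rule order_tendstoI)
      fix a :: real assume "a < 0" then show "\<forall>\<^sub>F n in sequentially. a < norm (L n z)"
        by (intro always_eventually allI) (smt (verit) norm_ge_zero)
    next
      fix a :: real assume a: "a > 0"
      \<comment> \<open>The error bound contains \<open>72 * e * (norm z)\<^sup>2\<close>, with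
        \<open>72 = 4 * 2 * 3\<^sup>2\<close>; this \<open>e\<close> keeps it below
        \<open>a / 2\<close>.\<close>
      define e where "e = a / (144 * ((norm z)\<^sup>2 + 1))"
      have e: "e > 0" using a by (simp add: e_def add_nonneg_pos)
      obtain C where C: "\<And>z. norm (f z) \<le> exp (C + e * (norm z)\<^sup>2)" using growth[OF e] by blast
      define K where "K = 4 * (2 * C + 1) * (norm z)\<^sup>2"
      have K: "(\<lambda>n. K / (real (Suc n))\<^sup>2) \<longlonglongrightarrow> 0" by real_asymp
      have ez: "72 * e * (norm z)\<^sup>2 \<le> a / 2"
      proof -
        have "72 * e * (norm z)\<^sup>2 \<le> 72 * e * ((norm z)\<^sup>2 + 1)" using e by simp
        also have "\<dots> = a / 2"
          by (simp add: e_def divide_simps) (smt (verit) zero_le_power2)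
        finally show ?thesis .
      qed
      have "\<forall>\<^sub>F n in sequentially. K / (real (Suc n))\<^sup>2 < a / 2"
        using order_tendstoD(2)[OF K, of "a / 2"] a by simp
      moreover have "\<forall>\<^sub>F n in sequentially. 2 * (norm z)\<^sup>2 \<le> (real (Suc n))\<^sup>2"
        by real_asymp
      ultimately show "\<forall>\<^sub>F n in sequentially. norm (L n z) < a"
      proof eventually_elim
        case (elim n)
        have "norm (L n z) \<le> 4 * (2 * (C + e * (3 * real (Suc n))\<^sup>2) + 1) * (norm z)\<^sup>2 / (real (Suc n))\<^sup>2"
          using elim C by (intro Lb) metis+
        also have "\<dots> = K / (real (Suc n))\<^sup>2 + 72 * e * (norm z)\<^sup>2"
          unfolding K_def by (simp add: divide_simps power_mult_distrib del: of_nat_Suc) (simp add: algebra_simps)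
        also have "\<dots> < a" using elim ez by linarith
        finally show ?case .
      qed
    qed
    then have "(\<lambda>n. (f z)\<^sup>2 * exp (- L n z)) \<longlonglongrightarrow> (f z)\<^sup>2 * exp (- 0)"
      by (intro tendsto_intros)
    moreover have "\<forall>\<^sub>F n in sequentially. (\<Prod>y\<leftarrow>Y n. (1 - z\<^sup>2 / (complex_of_real y)\<^sup>2)) = (f z)\<^sup>2 * exp (- L n z)"
    proof -
      have "\<forall>\<^sub>F n in sequentially. norm z < real (Suc n)" by real_asymp
      then show ?thesis
        by eventually_elim (simp add: YL exp_minus field_simps)
    qed
    ultimately show "(\<lambda>n. \<Prod>y\<leftarrow>Y n. (1 - z\<^sup>2 / (complex_of_real y)\<^sup>2)) \<longlonglongrightarrow> (f z)\<^sup>2"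
      by (simp add: tendsto_cong)
  qed
qed

section \<open>Consequences of the product approximation\<close>

lemma prod_list_nonneg_mono:
  fixes f g :: "'a \<Rightarrow> real"
  assumes "\<And>y. y \<in> set ys \<Longrightarrow> 0 \<le> f y \<and> f y \<le> g y"
  shows "0 \<le> (\<Prod>y\<leftarrow>ys. f y) \<and> (\<Prod>y\<leftarrow>ys. f y) \<le> (\<Prod>y\<leftarrow>ys. g y)"
  using assms
proof (induction ys)
  case (Cons y ys)
  have "0 \<le> f y" "f y \<le> g y" using Cons.prems by auto
  moreover have "0 \<le> (\<Prod>y\<leftarrow>ys. f y) \<and> (\<Prod>y\<leftarrow>ys. f y) \<le> (\<Prod>y\<leftarrow>ys. g y)"
    using Cons by simp
  ultimately show ?case by (auto intro!: mult_mono)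
qed auto

lemma norm_prod_list: "norm (\<Prod>y\<leftarrow>ys. f y :: complex) = (\<Prod>y\<leftarrow>ys. norm (f y))"
  by (induction ys) (auto simp: norm_mult)

text \<open>The factor is \<open>(y - w) * (y + w) / y\<^sup>2\<close>, and the distance of
  \<open>w\<close> to a real point grows with the modulus of its imaginary part when the real part
  is fixed. For \<open>y = 0\<close> division by zero makes both sides 1.\<close>

lemma norm_quadratic_factor_mono:
  assumes "Re u = Re v" "\<bar>Im u\<bar> \<le> \<bar>Im v\<bar>"
  shows "norm (1 - u\<^sup>2 / (complex_of_real y)\<^sup>2) \<le> norm (1 - v\<^sup>2 / (complex_of_real y)\<^sup>2)"
proof (cases "y = 0")
  case False
  have eq: "1 - w\<^sup>2 / (complex_of_real y)\<^sup>2 = (y - w) * (y + w) / (complex_of_real y)\<^sup>2" for w :: complex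
    using False by (simp add: field_simps power2_eq_square)
  have sq: "(Im u)\<^sup>2 \<le> (Im v)\<^sup>2" using assms(2) by (simp add: abs_le_square_iff)
  have "norm (y - u) \<le> norm (y - v)" "norm (y + u) \<le> norm (y + v)"
    unfolding cmod_def using assms(1) sq by (simp_all add: power2_commute)
  then show ?thesis
    unfolding eq[of u] eq[of v] norm_divide norm_mult by (intro divide_right_mono mult_mono) auto
qed simp

text \<open>Lets continuity carry a constant value on an open half plane to the origin, where the
  functions concerned are known not to vanish.\<close>

lemma zero_in_closure_halfplane:
  "0 \<in> closure {w. Im w > 0}" "0 \<in> closure {w. Im w < 0}"
proof -
  have "\<exists>y\<in>{w. Im w > 0}. dist y 0 < e" "\<exists>y\<in>{w. Im w < 0}. dist y 0 < e" if "e > 0" for e :: real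
    using that by (auto simp: norm_mult norm_divide intro: exI[of _ "\<i> * complex_of_real (e / 2)"]
        exI[of _ "- (\<i> * complex_of_real (e / 2))"])
  then show "0 \<in> closure {w. Im w > 0}" "0 \<in> closure {w. Im w < 0}"
    unfolding closure_approachable by blast+
qed

text \<open>The normalised entire characteristic functions of even measures with all Gaussian
  moments and only real zeros are instances. \<open>growth\<close> expresses order at most 2 and, in
  the case of order 2, minimal type.\<close>

locale even_real_zeros =
  fixes f :: "complex \<Rightarrow> complex"
  assumes holo: "f holomorphic_on UNIV" and f0: "f 0 = 1" and even: "\<And>z. f (- z) = f z"
    and real_zeros: "\<And>z. f z = 0 \<Longrightarrow> z \<in> \<real>"
    and growth: "\<And>e. e > 0 \<Longrightarrow> \<exists>C. \<forall>z. norm (f z) \<le> exp (C + e * (norm z)\<^sup>2)"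
begin

text \<open>Every quadratic factor of the approximating products has this monotonicity, so their
  limit \<open>(f z)\<^sup>2\<close> has it, and so does \<open>f\<close>.\<close>

lemma norm_mono_Im:
  assumes "Re u = Re v" "\<bar>Im u\<bar> \<le> \<bar>Im v\<bar>"
  shows "norm (f u) \<le> norm (f v)"
proof -
  obtain Y where Y: "\<And>z. (\<lambda>n. \<Prod>y\<leftarrow>Y n. (1 - z\<^sup>2 / (complex_of_real y)\<^sup>2)) \<longlonglongrightarrow> (f z)\<^sup>2"
    using even_entire_square_product_limit[OF holo f0 even real_zeros growth] by metis
  have "norm ((f u)\<^sup>2) \<le> norm ((f v)\<^sup>2)"
  proof (rule LIMSEQ_le[OF tendsto_norm[OF Y] tendsto_norm[OF Y]], intro exI allI impI)
    fix n
    show "norm (\<Prod>y\<leftarrow>Y n. (1 - u\<^sup>2 / (complex_of_real y)\<^sup>2)) \<le> norm (\<Prod>y\<leftarrow>Y n. (1 - v\<^sup>2 / (complex_of_real y)\<^sup>2))"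
      unfolding norm_prod_list
      using prod_list_nonneg_mono[where ys = "Y n"] norm_quadratic_factor_mono[OF assms] by (smt (verit) norm_ge_zero)
  qed
  then show ?thesis by (simp add: norm_power power_mono_iff)
qed

text \<open>For \<open>z\<close> in the upper half plane, \<open>z - \<i> c\<close> is at most as
  far from the real axis as \<open>z + \<i> c\<close>, so \<open>norm_mono_Im\<close> compares the
  two values of \<open>f\<close>. They can cancel only if their moduli are equal, which is the
  extremal case of the maximum modulus principle.\<close>

lemma shift_average_real_zeros:
  assumes "c \<ge> 0" and "f (z0 + \<i> * complex_of_real c) + f (z0 - \<i> * complex_of_real c) = 0"
  shows "z0 \<in> \<real>"
proof -
  define S where "S = (\<lambda>z. f (z + \<i> * complex_of_real c) + f (z - \<i> * complex_of_real c))"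
  have comp: "(\<lambda>z. f (z + a)) holomorphic_on UNIV" for a
    using holomorphic_on_compose_gen[of "\<lambda>z. z + a" UNIV f UNIV] holo
    by (auto simp: o_def holomorphic_on_add)
  have S: "S holomorphic_on UNIV"
    unfolding S_def using comp comp[of "- (\<i> * complex_of_real c)"] by (auto intro!: holomorphic_intros)
  have S_even: "S (- z) = S z" for z
    using even[of "z + \<i> * c"] even[of "z - \<i> * c"] by (simp add: S_def add.commute)
  \<comment> \<open>By evenness \<open>S 0 = 2 * f (\<i> c)\<close>. For \<open>c > 0\<close> the
    point is not real; for \<open>c = 0\<close> the value of \<open>f\<close> there is 1.\<close>
  have S0: "S 0 \<noteq> 0"
  proof
    assume "S 0 = 0"
    then have "f (\<i> * c) = 0" using even[of "\<i> * c"] by (simp add: S_def)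
    with real_zeros[OF this] f0 show False by (auto simp: complex_is_Real_iff)
  qed
  have key: "S z \<noteq> 0" if z: "Im z > 0" for z
  proof
    assume Sz: "S z = 0"
    \<comment> \<open>This quotient has modulus at most 1 in the upper half plane, so it can take the value \<open>-1\<close>
      there only if it is constant, contradicting \<open>h 0 = 1\<close> by continuity.\<close>
    define h where "h w = f (w - \<i> * complex_of_real c) / f (w + \<i> * complex_of_real c)" for w
    have ne: "f (w + \<i> * c) \<noteq> 0" if "Im w > 0" for w
      using real_zeros[of "w + \<i> * c"] that \<open>c \<ge> 0\<close> by (auto simp: complex_is_Real_iff)
    have hz: "h z = - 1"
      using Sz ne[OF z] by (simp add: S_def h_def field_simps add_eq_0_iff)
    have "h constant_on {w. Im w > 0}"
    proof (rule maximum_modulus_principle)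
      show "h holomorphic_on {w. Im w > 0}"
        unfolding h_def using comp comp[of "- (\<i> * complex_of_real c)"] ne
        by (intro holomorphic_intros) (auto intro: holomorphic_on_subset)
      show "open {w. Im w > 0}" "open {w. Im w > 0}" by (simp_all add: open_halfspace_Im_gt)
      show "connected {w. Im w > 0}" by (intro convex_connected convex_halfspace_Im_gt)
      show "norm (h w) \<le> norm (h z)" if "w \<in> {w. Im w > 0}" for w
        using norm_mono_Im[of "w - \<i> * c" "w + \<i> * c"] that \<open>c \<ge> 0\<close> ne[of w] unfolding hz
        by (simp add: h_def norm_divide divide_le_eq)
    qed (use z in auto)
    then have "h w = - 1" if "Im w > 0" for w
      using hz z that unfolding constant_on_def by (metis mem_Collect_eq)
    then have "S w = 0" if "Im w > 0" for w
      using that ne[OF that] by (simp add: S_def h_def divide_eq_minus_1_iff)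
    then have "S w = 0" if "w \<in> closure {w. Im w > 0}" for w
      using continuous_constant_on_closure[of "{w. Im w > 0}" S 0 w] that
        holomorphic_on_imp_continuous_on[OF holomorphic_on_subset[OF S]] by auto
    with zero_in_closure_halfplane(1) S0 show False by blast
  qed
  have "Im z0 = 0"
  proof (rule ccontr)
    assume "Im z0 \<noteq> 0"
    moreover have "S z0 = 0" "S (- z0) = 0" using assms(2) S_even[of z0] by (simp_all add: S_def)
    ultimately show False using key[of z0] key[of "- z0"] by (cases "Im z0 > 0") auto
  qed
  then show ?thesis by (simp add: complex_is_Real_iff)
qed

text \<open>All zeros \<open>y\<close> satisfy \<open>\<bar>y\<bar> > d\<close>. With
  \<open>x = d\<^sup>2 / y\<^sup>2 < 1\<close> and \<open>k = s\<^sup>2 / d\<^sup>2\<close>, the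
  factor at \<open>\<i> s\<close> is
  \<open>1 + k x \<le> exp (k x) \<le> (1 - x) powr (- k)\<close>, the power of the factor at
  \<open>d\<close>; multiplying over the zeros and passing to the limit gives the bound.\<close>

lemma norm_imaginary_axis_le:
  assumes "d > 0" and nz: "\<And>t. \<bar>t\<bar> \<le> d \<Longrightarrow> f (complex_of_real t) \<noteq> 0"
  shows "norm (f (\<i> * complex_of_real s)) \<le> norm (f (complex_of_real d)) powr (- (s\<^sup>2 / d\<^sup>2))"
proof -
  obtain Y where Y0: "\<And>n y. y \<in> set (Y n) \<Longrightarrow> f (complex_of_real y) = 0"
    and Y: "\<And>z. (\<lambda>n. \<Prod>y\<leftarrow>Y n. (1 - z\<^sup>2 / (complex_of_real y)\<^sup>2)) \<longlonglongrightarrow> (f z)\<^sup>2"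
    using even_entire_square_product_limit[OF holo f0 even real_zeros growth] by metis
  define k where "k = s\<^sup>2 / d\<^sup>2"
  have fac: "0 \<le> norm (1 - (\<i> * complex_of_real s)\<^sup>2 / (complex_of_real y)\<^sup>2) \<and>
      norm (1 - (\<i> * complex_of_real s)\<^sup>2 / (complex_of_real y)\<^sup>2) \<le>
      norm (1 - (complex_of_real d)\<^sup>2 / (complex_of_real y)\<^sup>2) powr (- k)" if "y \<in> set (Y n)" for y n
  proof -
    have yd: "d < \<bar>y\<bar>" using nz[of y] Y0[OF that] by force
    then have "d\<^sup>2 < \<bar>y\<bar>\<^sup>2" using \<open>d > 0\<close> by (intro power_strict_mono) auto
    then have y: "d\<^sup>2 < y\<^sup>2" by simp
    define x where "x = d\<^sup>2 / y\<^sup>2"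
    have x: "0 < x" "x < 1" using y yd \<open>d > 0\<close> by (auto simp: x_def)
    have "1 + k * x \<le> exp (k * x)" by (rule exp_ge_add_one_self)
    also have "\<dots> \<le> exp (- k * ln (1 - x))"
    proof -
      have "ln (1 - x) \<le> - x" using ln_le_minus_one[of "1 - x"] x by simp
      then have "k * x \<le> k * (- ln (1 - x))" by (intro mult_left_mono) (auto simp: k_def)
      then show ?thesis by simp
    qed
    also have "\<dots> = (1 - x) powr (- k)" using x by (simp add: powr_def)
    finally have main: "1 + k * x \<le> (1 - x) powr (- k)" .
    have kx: "k * x = s\<^sup>2 / y\<^sup>2" using \<open>d > 0\<close> by (simp add: k_def x_def)
    have "1 - (\<i> * complex_of_real s)\<^sup>2 / (complex_of_real y)\<^sup>2 = complex_of_real (1 + k * x)"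
      unfolding kx by (simp add: power_mult_distrib)
    then have 1: "norm (1 - (\<i> * complex_of_real s)\<^sup>2 / (complex_of_real y)\<^sup>2) = 1 + k * x"
      using x by (simp only: norm_of_real) (simp add: k_def)
    have "1 - (complex_of_real d)\<^sup>2 / (complex_of_real y)\<^sup>2 = complex_of_real (1 - x)"
      by (simp add: x_def)
    then have 2: "norm (1 - (complex_of_real d)\<^sup>2 / (complex_of_real y)\<^sup>2) = 1 - x"
      using x by (simp only: norm_of_real)
    show ?thesis using main unfolding 1 2 by (simp add: kx)
  qed
  have prod_powr: "(\<Prod>y\<leftarrow>ys. norm (F y) powr a) = norm (\<Prod>y\<leftarrow>ys. F y) powr a" for ys :: "real list" and F :: "real \<Rightarrow> complex" and a
    by (induction ys) (auto simp: norm_mult powr_mult)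
  \<comment> \<open>A nonzero limit of the bases is what allows passing to the limit in
    \<open>powr\<close> with a negative exponent.\<close>
  have fd: "norm ((f d)\<^sup>2) \<noteq> 0" using nz[of d] \<open>d > 0\<close> by simp
  have "norm ((f (\<i> * s))\<^sup>2) \<le> norm ((f d)\<^sup>2) powr (- k)"
  proof (rule LIMSEQ_le[OF tendsto_norm[OF Y] tendsto_powr[OF tendsto_norm[OF Y] tendsto_const fd]], intro exI allI impI)
    fix n
    show "norm (\<Prod>y\<leftarrow>Y n. (1 - (\<i> * s)\<^sup>2 / (complex_of_real y)\<^sup>2)) \<le>
          norm (\<Prod>y\<leftarrow>Y n. (1 - (complex_of_real d)\<^sup>2 / (complex_of_real y)\<^sup>2)) powr (- k)"
      using prod_list_nonneg_mono[of "Y n", OF fac] unfolding prod_powr by (simp only: norm_prod_list)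
  qed
  also have "\<dots> = (norm (f d) powr (- k))\<^sup>2"
    by (simp add: norm_mult power2_eq_square powr_mult)
  finally have "(norm (f (\<i> * s)))\<^sup>2 \<le> (norm (f d) powr (- k))\<^sup>2" by (simp add: norm_power)
  then show ?thesis unfolding k_def by (rule power2_le_imp_le) simp
qed

end

text \<open>Hurwitz's theorem is applied on the two open half planes, where no \<open>F n\<close>
  vanishes. Its exceptional case of a constant limit is harmless: by continuity the constant is
  \<open>g 0\<close>, which is nonzero.\<close>

lemma Hurwitz_real_zeros:
  fixes F :: "nat \<Rightarrow> complex \<Rightarrow> complex"
  assumes F: "\<And>n. F n holomorphic_on UNIV" and g: "g holomorphic_on UNIV"
    and lim: "\<And>K. compact K \<Longrightarrow> uniform_limit K F g sequentially"
    and real: "\<And>n z. F n z = 0 \<Longrightarrow> z \<in> \<real>" and g0: "g 0 \<noteq> 0" and gz: "g z = 0"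
  shows "z \<in> \<real>"
proof -
  have key: "g w \<noteq> 0" if S: "open S" "connected S" "\<And>w. w \<in> S \<Longrightarrow> w \<notin> \<real>" "0 \<in> closure S" and w: "w \<in> S" for S w
  proof (cases "g constant_on S")
    case True
    then obtain c where c: "\<And>z. z \<in> S \<Longrightarrow> g z = c" by (auto simp: constant_on_def)
    have "g 0 = c"
      using continuous_constant_on_closure[of S g c 0] c S(4)
        holomorphic_on_imp_continuous_on[OF holomorphic_on_subset[OF g]] by auto
    with c[OF w] g0 show ?thesis by simp
  next
    case False
    have "F n z \<noteq> 0" if "z \<in> S" for n z using real[of n z] S(3)[OF that] by blast
    then show ?thesis
      using F g lim by (intro Hurwitz_no_zeros[OF S(1,2) _ _ _ False _ w, of F])
        (auto intro: holomorphic_on_subset)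
  qed
  have "\<not> Im z > 0"
    using key[of "{w. Im w > 0}" z] gz
    by (auto simp: open_halfspace_Im_gt convex_connected convex_halfspace_Im_gt zero_in_closure_halfplane complex_is_Real_iff)
  moreover have "\<not> Im z < 0"
    using key[of "{w. Im w < 0}" z] gz
    by (auto simp: open_halfspace_Im_lt convex_connected convex_halfspace_Im_lt zero_in_closure_halfplane complex_is_Real_iff)
  ultimately show ?thesis by (simp add: complex_is_Real_iff)
qed

section \<open>Entire characteristic functions\<close>

text \<open>The derivative of \<open>x\<^sup>2 / 2 - ln (cosh x)\<close> is
  \<open>x - tanh x\<close>, which is nonnegative for \<open>x \<ge> 0\<close> because
  \<open>y * cosh y - sinh y\<close> vanishes at 0 and has derivative
  \<open>y * sinh y\<close>.\<close>

lemma cosh_le_exp_square: "cosh x \<le> exp (x\<^sup>2 / 2)" for x :: real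
proof -
  define g where "g x = x\<^sup>2 / 2 - ln (cosh x)" for x :: real
  have "g 0 \<le> g \<bar>x\<bar>"
  proof (rule DERIV_nonneg_imp_nondecreasing[of 0 "\<bar>x\<bar>" g])
    fix y :: real assume y: "0 \<le> y" "y \<le> \<bar>x\<bar>"
    have "(g has_real_derivative y - sinh y / cosh y) (at y)"
      unfolding g_def by (auto intro!: derivative_eq_intros simp: divide_simps)
    moreover have "y - sinh y / cosh y \<ge> 0"
    proof -
      have "(\<lambda>y. y * cosh y - sinh y) 0 \<le> (\<lambda>y. y * cosh y - sinh y) y"
      proof (rule DERIV_nonneg_imp_nondecreasing[of 0 y "\<lambda>y. y * cosh y - sinh y"])
        fix u :: real assume u: "0 \<le> u" "u \<le> y"
        have "((\<lambda>y. y * cosh y - sinh y) has_real_derivative u * sinh u) (at u)"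
          by (auto intro!: derivative_eq_intros)
        moreover have "u * sinh u \<ge> 0" using u by simp
        ultimately show "\<exists>D. ((\<lambda>y. y * cosh y - sinh y) has_real_derivative D) (at u) \<and> D \<ge> 0" by blast
      qed (use y in auto)
      then show ?thesis by (simp add: field_simps)
    qed
    ultimately show "\<exists>D. (g has_real_derivative D) (at y) \<and> D \<ge> 0" by blast
  qed auto
  then have "ln (cosh x) \<le> x\<^sup>2 / 2" by (simp add: g_def)
  then show ?thesis by (metis cosh_real_pos exp_le_cancel_iff exp_ln)
qed

text \<open>With \<open>n = k + 1\<close> the base is \<open>1 + s t\<^sup>2 / n\<close> up to
  higher order, so the scale \<open>sqrt (2 s / n)\<close> is the one that produces
  \<open>exp (s t\<^sup>2)\<close>.\<close>

lemma cosh_scaled_power_limit: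
  assumes "s \<ge> 0"
  shows "(\<lambda>k. cosh (sqrt (2 * s / real (Suc k)) * t) ^ Suc k) \<longlonglongrightarrow> exp (s * t\<^sup>2)"
proof -
  define a where "a = sqrt (2 * s) * \<bar>t\<bar>"
  have a2: "a\<^sup>2 / 2 = s * t\<^sup>2" using assms by (simp add: a_def power_mult_distrib)
  have eq: "cosh (sqrt (2 * s / real (Suc k)) * t) = cosh (a / sqrt (real (Suc k)))" for k
  proof -
    have "\<bar>sqrt (2 * s / real (Suc k)) * t\<bar> = \<bar>a / sqrt (real (Suc k))\<bar>"
      using assms by (simp add: a_def abs_mult real_sqrt_divide)
    then show ?thesis by (metis cosh_real_abs)
  qed
  have "(\<lambda>k. cosh (a / sqrt (real (Suc k))) ^ Suc k) \<longlonglongrightarrow> exp (a\<^sup>2 / 2)"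
  proof (cases "a = 0")
    case False
    then have "a > 0" using assms by (simp add: a_def)
    then show ?thesis unfolding cosh_field_def power2_eq_square by real_asymp
  qed auto
  then show ?thesis by (simp only: eq a2)
qed

text \<open>Provides the dominating function for the limit above.\<close>

lemma cosh_scaled_power_le:
  assumes "s \<ge> 0"
  shows "cosh (sqrt (2 * s / real (Suc k)) * t) ^ Suc k \<le> exp (s * t\<^sup>2)"
proof -
  have "cosh (sqrt (2 * s / real (Suc k)) * t) ^ Suc k \<le> exp ((sqrt (2 * s / real (Suc k)) * t)\<^sup>2 / 2) ^ Suc k"
    by (intro power_mono cosh_le_exp_square) auto
  also have "\<dots> = exp (real (Suc k) * ((sqrt (2 * s / real (Suc k)) * t)\<^sup>2 / 2))"
    by (rule exp_of_nat_mult[symmetric])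
  also have "real (Suc k) * ((sqrt (2 * s / real (Suc k)) * t)\<^sup>2 / 2) = s * t\<^sup>2"
    using assms by (simp add: power_mult_distrib del: of_nat_Suc)
  finally show ?thesis .
qed

text \<open>The truncation at 2 makes the right side bounded and continuous, so its integrals pass
  to weak limits although second moments need not.\<close>

lemma one_minus_cos_le: "1 - cos x \<le> min 2 (x\<^sup>2 / 2)" for x :: real
proof -
  have "cos x = 1 - 2 * (sin (x / 2))\<^sup>2"
    using cos_double_sin[of "x / 2"] by simp
  moreover have "(sin (x / 2))\<^sup>2 \<le> (x / 2)\<^sup>2"
    using abs_sin_x_le_abs_x[of "x / 2"] unfolding abs_le_square_iff .
  ultimately show ?thesis using cos_ge_minus_one[of x] by (simp add: power_divide)
qed

text \<open>Young's inequality with weight \<open>e\<close>: exponential growth in \<open>t\<close>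
  is absorbed by a Gaussian weight, at the cost of an arbitrarily small multiple of
  \<open>a\<^sup>2\<close>.\<close>

lemma abs_mult_le_weighted_squares:
  fixes a t e :: real
  assumes "e > 0"
  shows "a * \<bar>t\<bar> \<le> e * a\<^sup>2 + 1 / (4 * e) * t\<^sup>2"
proof -
  have "0 \<le> (2 * e * a - \<bar>t\<bar>)\<^sup>2 / (4 * e)" using assms by simp
  also have "\<dots> = e * a\<^sup>2 + 1 / (4 * e) * t\<^sup>2 - a * \<bar>t\<bar>"
    using assms by (simp add: power2_diff field_simps power2_eq_square)
  finally show ?thesis by simp
qed

section \<open>Characteristic functions of a complex argument and their moment conditions\<close>

definition entire_char :: "real measure \<Rightarrow> complex \<Rightarrow> complex" where
  "entire_char M z = (LINT t|M. exp (\<i> * z * complex_of_real t))"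

definition exp_moments :: "real measure \<Rightarrow> bool" where
  "exp_moments M \<longleftrightarrow> sets M = sets borel \<and> (\<forall>s. integrable M (\<lambda>t. exp (s * \<bar>t\<bar>)))"

lemma norm_exp_i_mult: "norm (exp (\<i> * z * complex_of_real t)) = exp (- (Im z * t))"
  by (simp add: norm_exp_eq_Re)

lemma norm_exp_i_mult_le: "norm (exp (\<i> * z * complex_of_real t)) \<le> exp (\<bar>Im z\<bar> * \<bar>t\<bar>)"
  unfolding norm_exp_i_mult by (simp flip: abs_mult)

lemma exp_moments_integrable:
  assumes "exp_moments M"
  shows "integrable M (\<lambda>t. exp (\<i> * z * complex_of_real t))"
proof (rule Bochner_Integration.integrable_bound)
  have [measurable_cong]: "sets M = sets borel" using assms by (simp add: exp_moments_def)
  show "integrable M (\<lambda>t. exp (\<bar>Im z\<bar> * \<bar>t\<bar>))" using assms by (simp add: exp_moments_def)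
  show "(\<lambda>t. exp (\<i> * z * complex_of_real t)) \<in> borel_measurable M" by measurable
  show "AE t in M. norm (exp (\<i> * z * complex_of_real t)) \<le> norm (exp (\<bar>Im z\<bar> * \<bar>t\<bar>))"
    using norm_exp_i_mult_le by simp
qed

lemma norm_entire_char_le:
  assumes "exp_moments M" and "\<bar>Im z\<bar> \<le> a"
  shows "norm (entire_char M z) \<le> (LINT t|M. exp (a * \<bar>t\<bar>))"
proof -
  have "norm (entire_char M z) \<le> (LINT t|M. norm (exp (\<i> * z * complex_of_real t)))"
    unfolding entire_char_def by (rule integral_norm_bound)
  also have "\<dots> \<le> (LINT t|M. exp (a * \<bar>t\<bar>))"
  proof (rule integral_mono)
    show "integrable M (\<lambda>t. norm (exp (\<i> * z * complex_of_real t)))"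
      using exp_moments_integrable[OF assms(1)] by (rule integrable_norm)
    show "integrable M (\<lambda>t. exp (a * \<bar>t\<bar>))" using assms(1) by (simp add: exp_moments_def)
    show "norm (exp (\<i> * z * complex_of_real t)) \<le> exp (a * \<bar>t\<bar>)" for t
      using norm_exp_i_mult_le[of z t] mult_right_mono[OF assms(2), of "\<bar>t\<bar>"] by (smt (verit) abs_ge_zero exp_le_cancel_iff)
  qed
  finally show ?thesis .
qed

text \<open>The exponential series is integrated termwise. Its partial sums of norms are dominated
  by the integrable function \<open>exp (norm z * \<bar>t\<bar>)\<close>, which yields a power
  series that converges everywhere.\<close>

lemma entire_char_holomorphic:
  assumes M: "exp_moments M"
  shows "entire_char M holomorphic_on UNIV"
proof -
  have [measurable_cong]: "sets M = sets borel" using M by (simp add: exp_moments_def)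
  define a where "a k = (LINT t|M. (\<i> * complex_of_real t) ^ k / fact k)" for k
  have sums: "(\<lambda>k. a k * z ^ k) sums entire_char M z" for z
  proof -
    define f where "f k t = (\<i> * z * complex_of_real t) ^ k / fact k" for k and t :: real
    have f_sums: "(\<lambda>k. f k t) sums exp (\<i> * z * complex_of_real t)" for t
      using exp_converges[of "\<i> * z * complex_of_real t"] by (simp add: f_def scaleR_conv_of_real divide_inverse mult.commute)
    have nf: "norm (f k t) = (norm z * \<bar>t\<bar>) ^ k / fact k" for k t
      by (simp add: f_def norm_divide norm_power norm_mult)
    have nf_sums: "(\<lambda>k. norm (f k t)) sums exp (norm z * \<bar>t\<bar>)" for t
      using exp_converges[of "norm z * \<bar>t\<bar>"] unfolding nf by (simp add: divide_inverse mult.commute)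
    have fin: "(\<Sum>k<n. norm (f k t)) \<le> exp (norm z * \<bar>t\<bar>)" for n t
      using sum_le_suminf[of "\<lambda>k. norm (f k t)" "{..<n}"] nf_sums[of t] by (auto simp: sums_iff)
    have expint: "integrable M (\<lambda>t. exp (norm z * \<bar>t\<bar>))" using M by (simp add: exp_moments_def)
    have f_int: "integrable M (f k)" for k
    proof (rule Bochner_Integration.integrable_bound[OF expint])
      show "f k \<in> borel_measurable M" unfolding f_def by measurable
      show "AE t in M. norm (f k t) \<le> norm (exp (norm z * \<bar>t\<bar>))"
      proof (rule AE_I2)
        fix t
        have "norm (f k t) \<le> (\<Sum>k<Suc k. norm (f k t))" by (simp add: sum_nonneg)
        with fin[where n = "Suc k" and t = t] show "norm (f k t) \<le> norm (exp (norm z * \<bar>t\<bar>))" by simp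
      qed
    qed
    have "(\<lambda>k. integral\<^sup>L M (f k)) sums (LINT t|M. (\<Sum>k. f k t))"
    proof (rule sums_integral[OF f_int])
      show "AE t in M. summable (\<lambda>k. norm (f k t))"
        using nf_sums by (auto simp: sums_iff)
      show "summable (\<lambda>k. LINT t|M. norm (f k t))"
      proof (rule summableI_nonneg_bounded)
        show "(\<Sum>k<n. LINT t|M. norm (f k t)) \<le> (LINT t|M. exp (norm z * \<bar>t\<bar>))" for n
        proof -
          have "(\<Sum>k<n. LINT t|M. norm (f k t)) = (LINT t|M. (\<Sum>k<n. norm (f k t)))"
            by (rule Bochner_Integration.integral_sum[symmetric]) (intro integrable_norm f_int)
          also have "\<dots> \<le> (LINT t|M. exp (norm z * \<bar>t\<bar>))"
            by (intro integral_mono expint fin Bochner_Integration.integrable_sum integrable_norm f_int)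
          finally show ?thesis .
        qed
      qed simp
    qed
    also have "(LINT t|M. (\<Sum>k. f k t)) = entire_char M z"
      unfolding entire_char_def using f_sums by (simp add: sums_iff)
    also have "(\<lambda>k. integral\<^sup>L M (f k)) = (\<lambda>k. a k * z ^ k)"
    proof
      fix k
      have "f k = (\<lambda>t. (\<i> * complex_of_real t) ^ k / fact k * z ^ k)"
        by (auto simp: f_def power_mult_distrib fun_eq_iff)
      then show "integral\<^sup>L M (f k) = a k * z ^ k" unfolding a_def by simp
    qed
    finally show ?thesis .
  qed
  have "entire_char M field_differentiable at z" for z
  proof -
    have "entire_char M holomorphic_on ball 0 (norm z + 1)"
      by (rule power_series_holomorphic[of 0 _ a]) (use sums in auto)
    then show ?thesis
      by (rule holomorphic_on_imp_differentiable_at) auto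
  qed
  then show ?thesis by (auto simp: holomorphic_on_def intro: field_differentiable_at_within)
qed

lemma entire_char_even:
  assumes "sets M = sets borel" "even_measure M"
  shows "entire_char M (- z) = entire_char M z"
proof -
  have [measurable_cong]: "sets M = sets borel" by fact
  have "entire_char M z = entire_char (distr M borel uminus) z"
    using assms(2) by (simp add: even_measure_def)
  also have "\<dots> = entire_char M (- z)"
    unfolding entire_char_def by (subst integral_distr) simp_all
  finally show ?thesis by simp
qed

lemma even_measure_density:
  fixes w :: "real \<Rightarrow> ennreal"
  assumes M: "sets M = sets borel" "even_measure M" and w: "w \<in> borel_measurable borel" "\<And>t. w (- t) = w t"
  shows "even_measure (density M w)"
proof -
  have [measurable_cong]: "sets M = sets borel" by fact
  have "distr (density M (\<lambda>t. w (- t))) borel uminus = density (distr M borel uminus) w"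
    by (rule density_distr[symmetric]) (use w in simp_all)
  then show ?thesis using M(2) by (simp add: even_measure_def w(2))
qed

text \<open>The class in which the whole argument takes place: it is preserved by even positive
  weights of at most Gaussian growth. Positive mass permits division by
  \<open>entire_char M 0\<close>, and moments for every \<open>b\<close> give the growth condition
  of \<open>even_real_zeros\<close>.\<close>

definition gaussian_moments :: "real measure \<Rightarrow> bool" where
  "gaussian_moments M \<longleftrightarrow> sets M = sets borel \<and> even_measure M \<and> emeasure M UNIV > 0 \<and>
     (\<forall>b. integrable M (\<lambda>t. exp (b * t\<^sup>2)))"

lemma gaussian_imp_exp_moments:
  assumes "gaussian_moments M"
  shows "exp_moments M"
  unfolding exp_moments_def
proof (intro conjI allI)
  show [measurable_cong]: "sets M = sets borel" using assms by (simp add: gaussian_moments_def)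
  fix s
  have "integrable M (\<lambda>t. exp (1 / 4 * t\<^sup>2))"
    using assms unfolding gaussian_moments_def by blast
  then have "integrable M (\<lambda>t. exp (s\<^sup>2) * exp (1 / 4 * t\<^sup>2))"
    by (rule integrable_mult_right)
  then show "integrable M (\<lambda>t. exp (s * \<bar>t\<bar>))"
    by (rule Bochner_Integration.integrable_bound)
      (use abs_mult_le_weighted_squares[of 1 s] in \<open>auto simp flip: exp_add\<close>)
qed

lemma gaussian_moments_density:
  assumes M: "gaussian_moments M" and w: "w \<in> borel_measurable borel" "\<And>t. w (- t) = w t"
    and w_pos: "\<And>t. 0 < w t" and w_le: "\<And>t. w t \<le> B * exp (c * t\<^sup>2)"
  shows "gaussian_moments (density M (\<lambda>t. ennreal (w t)))"
  unfolding gaussian_moments_def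
proof (intro conjI allI)
  have sM [measurable_cong]: "sets M = sets borel" using M by (simp add: gaussian_moments_def)
  note [measurable] = w(1)
  show "sets (density M (\<lambda>t. ennreal (w t))) = sets borel" using sM by simp
  show "even_measure (density M (\<lambda>t. ennreal (w t)))"
    using M w by (intro even_measure_density) (auto simp: gaussian_moments_def)
  show "integrable (density M (\<lambda>t. ennreal (w t))) (\<lambda>t. exp (b * t\<^sup>2))" for b
  proof -
    have "integrable M (\<lambda>t. B * exp ((b + c) * t\<^sup>2))"
      using M by (intro integrable_mult_right) (simp add: gaussian_moments_def)
    then have "integrable M (\<lambda>t. w t *\<^sub>R exp (b * t\<^sup>2))"
    proof (rule Bochner_Integration.integrable_bound)
      show "AE t in M. norm (w t *\<^sub>R exp (b * t\<^sup>2)) \<le> norm (B * exp ((b + c) * t\<^sup>2))"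
      proof (rule AE_I2)
        fix t
        have "w t * exp (b * t\<^sup>2) \<le> B * exp (c * t\<^sup>2) * exp (b * t\<^sup>2)"
          by (intro mult_right_mono w_le) simp
        also have "\<dots> = B * exp ((b + c) * t\<^sup>2)" by (simp add: distrib_right exp_add)
        finally show "norm (w t *\<^sub>R exp (b * t\<^sup>2)) \<le> norm (B * exp ((b + c) * t\<^sup>2))"
          using w_pos[of t] by (simp add: abs_of_pos)
      qed
    qed measurable
    then show ?thesis by (subst integrable_density) (use w_pos in \<open>auto intro: less_imp_le\<close>)
  qed
  have "emeasure (density M (\<lambda>t. ennreal (w t))) UNIV = (\<integral>\<^sup>+ t. ennreal (w t) \<partial>M)"
    using sM by (subst emeasure_density) (auto simp: sets_eq_imp_space_eq[OF sM])
  moreover have "(\<integral>\<^sup>+ t. ennreal (w t) \<partial>M) \<noteq> 0"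
  proof
    assume "(\<integral>\<^sup>+ t. ennreal (w t) \<partial>M) = 0"
    then have "AE t in M. False"
      using w_pos by (subst (asm) nn_integral_0_iff_AE) (auto simp: ennreal_eq_0_iff not_le)
    then have "emeasure M (space M) = 0" by (subst (asm) AE_iff_measurable[of "space M"]) auto
    then show False using M by (simp add: gaussian_moments_def sets_eq_imp_space_eq[OF sM])
  qed
  ultimately show "emeasure (density M (\<lambda>t. ennreal (w t))) UNIV > 0"
    by (simp add: zero_less_iff_neq_zero)
qed

lemma entire_char_density:
  assumes [measurable_cong]: "sets M = sets borel" and [measurable]: "w \<in> borel_measurable borel" and "\<And>t. 0 \<le> w t"
  shows "entire_char (density M (\<lambda>t. ennreal (w t))) z = (LINT t|M. exp (\<i> * z * complex_of_real t) * complex_of_real (w t))"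
  unfolding entire_char_def using assms(3)
  by (subst integral_density) (auto simp: scaleR_conv_of_real mult.commute)

text \<open>A shift of the argument by \<open>\<i> c\<close> multiplies the integrand by
  \<open>exp (- c t)\<close>, so averaging the two opposite shifts amounts to the weight
  \<open>cosh (c t)\<close>. This translates \<open>shift_average_real_zeros\<close> into a
  statement on measures.\<close>

lemma entire_char_density_cosh:
  assumes M: "exp_moments M"
  shows "entire_char (density M (\<lambda>t. ennreal (cosh (c * t)))) z =
    (entire_char M (z + \<i> * complex_of_real c) + entire_char M (z - \<i> * complex_of_real c)) / 2"
proof -
  have sM [measurable_cong]: "sets M = sets borel" using M by (simp add: exp_moments_def)
  have "entire_char (density M (\<lambda>t. ennreal (cosh (c * t)))) z =
      (LINT t|M. exp (\<i> * z * complex_of_real t) * complex_of_real (cosh (c * t)))"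
    by (rule entire_char_density[OF sM]) (auto simp: cosh_def)
  also have "\<dots> = (LINT t|M. (exp (\<i> * (z + \<i> * complex_of_real c) * complex_of_real t) +
      exp (\<i> * (z - \<i> * complex_of_real c) * complex_of_real t)) / 2)"
    by (intro Bochner_Integration.integral_cong refl)
      (simp add: cosh_field_def exp_of_real[symmetric] algebra_simps exp_add exp_diff exp_minus field_simps flip: exp_add)
  also have "\<dots> = (entire_char M (z + \<i> * complex_of_real c) + entire_char M (z - \<i> * complex_of_real c)) / 2"
    unfolding entire_char_def using exp_moments_integrable[OF M] by simp
  finally show ?thesis .
qed

lemma entire_char_0: "entire_char M 0 = complex_of_real (measure M (space M))"
  by (simp add: entire_char_def scaleR_conv_of_real)

lemma gaussian_moments_measure_pos:
  assumes "gaussian_moments M"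
  shows "finite_measure M" "measure M (space M) > 0"
proof -
  have "integrable M (\<lambda>t. exp (0 * t\<^sup>2))" using assms unfolding gaussian_moments_def by blast
  then have "integrable M (\<lambda>_. 1 :: real)" by simp
  then have fin: "emeasure M (space M) < \<infinity>" by (simp add: integrable_iff_bounded)
  then show "finite_measure M" by (intro finite_measureI) auto
  have "emeasure M (space M) > 0"
    using assms sets_eq_imp_space_eq[of M borel] by (simp add: gaussian_moments_def)
  with fin show "measure M (space M) > 0" by (simp add: measure_def enn2real_positive_iff)
qed

text \<open>Young's inequality with \<open>a = norm z\<close> separates \<open>z\<close> from
  \<open>t\<close> and leaves the Gaussian moment with exponent \<open>1 / (4 * e)\<close>, finite
  for every \<open>e\<close>.\<close>

lemma entire_char_growth:
  assumes M: "gaussian_moments M" and "e > 0"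
  shows "\<exists>C. \<forall>z. norm (entire_char M z) \<le> exp (C + e * (norm z)\<^sup>2)"
proof -
  define I where "I = (LINT t|M. exp (1 / (4 * e) * t\<^sup>2))"
  have int: "integrable M (\<lambda>t. exp (1 / (4 * e) * t\<^sup>2))" using M unfolding gaussian_moments_def by blast
  have E: "exp_moments M" using M by (rule gaussian_imp_exp_moments)
  have "I \<ge> 0" unfolding I_def by simp
  \<comment> \<open>Only \<open>I \<ge> 0\<close> has been shown, hence the logarithm of
    \<open>I + 1\<close>.\<close>
  have "norm (entire_char M z) \<le> exp (ln (I + 1) + e * (norm z)\<^sup>2)" for z
  proof -
    have "norm (entire_char M z) \<le> (LINT t|M. exp (norm z * \<bar>t\<bar>))"
      by (rule norm_entire_char_le[OF E abs_Im_le_cmod])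
    also have "\<dots> \<le> (LINT t|M. exp (e * (norm z)\<^sup>2) * exp (1 / (4 * e) * t\<^sup>2))"
    proof (rule integral_mono)
      show "integrable M (\<lambda>t. exp (norm z * \<bar>t\<bar>))" using E by (simp add: exp_moments_def)
      show "integrable M (\<lambda>t. exp (e * (norm z)\<^sup>2) * exp (1 / (4 * e) * t\<^sup>2))" using int by simp
      show "exp (norm z * \<bar>t\<bar>) \<le> exp (e * (norm z)\<^sup>2) * exp (1 / (4 * e) * t\<^sup>2)" for t
        using abs_mult_le_weighted_squares[OF \<open>e > 0\<close>, of "norm z" t] by (simp flip: exp_add)
    qed
    also have "\<dots> = exp (e * (norm z)\<^sup>2) * I" unfolding I_def by simp
    also have "\<dots> \<le> exp (e * (norm z)\<^sup>2) * (I + 1)" by simp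
    also have "\<dots> = exp (ln (I + 1) + e * (norm z)\<^sup>2)" using \<open>I \<ge> 0\<close> by (simp add: exp_add)
    finally show ?thesis .
  qed
  then show ?thesis by blast
qed

section \<open>Gaussian tilts preserve the reality of zeros\<close>

definition only_real_zeros :: "real measure \<Rightarrow> bool" where
  "only_real_zeros M \<longleftrightarrow> (\<forall>z. entire_char M z = 0 \<longrightarrow> z \<in> \<real>)"

lemma even_real_zeros_entire_char:
  assumes M: "gaussian_moments M" and real: "only_real_zeros M"
  shows "even_real_zeros (\<lambda>z. entire_char M z / entire_char M 0)"
proof
  define m where "m = measure M (space M)"
  have m: "m > 0" using gaussian_moments_measure_pos[OF M] by (simp add: m_def)
  have e0: "entire_char M 0 = complex_of_real m" by (simp add: entire_char_0 m_def)
  show "(\<lambda>z. entire_char M z / entire_char M 0) holomorphic_on UNIV"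
    using entire_char_holomorphic[OF gaussian_imp_exp_moments[OF M]] m
    by (auto intro!: holomorphic_intros simp: e0)
  show "entire_char M 0 / entire_char M 0 = 1" using m by (simp add: e0)
  show "entire_char M (- z) / entire_char M 0 = entire_char M z / entire_char M 0" for z
    using M by (simp add: entire_char_even gaussian_moments_def)
  show "z \<in> \<real>" if "entire_char M z / entire_char M 0 = 0" for z
    using real that m by (auto simp: only_real_zeros_def e0)
  show "\<exists>C. \<forall>z. norm (entire_char M z / entire_char M 0) \<le> exp (C + e * (norm z)\<^sup>2)" if e: "e > 0" for e
  proof -
    obtain C where C: "\<And>z. norm (entire_char M z) \<le> exp (C + e * (norm z)\<^sup>2)"
      using entire_char_growth[OF M e] by blast
    have "norm (entire_char M z / entire_char M 0) \<le> exp ((C - ln m) + e * (norm z)\<^sup>2)" for z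
      using C[of z] m by (simp add: e0 norm_divide exp_add exp_diff field_simps)
    then show ?thesis by blast
  qed
qed

lemma gaussian_moments_cosh_power:
  assumes M: "gaussian_moments M"
  shows "gaussian_moments (density M (\<lambda>t. ennreal (cosh (c * t) ^ k)))"
proof (rule gaussian_moments_density[OF M, where B = 1 and c = "k * c\<^sup>2 / 2"])
  show "(\<lambda>t. cosh (c * t) ^ k) \<in> borel_measurable borel" unfolding cosh_def by measurable
  fix t
  have "cosh (c * t) ^ k \<le> exp ((c * t)\<^sup>2 / 2) ^ k"
    by (intro power_mono cosh_le_exp_square) simp
  also have "\<dots> = 1 * exp (k * c\<^sup>2 / 2 * t\<^sup>2)"
    by (simp add: power_mult_distrib flip: exp_of_nat_mult)
  finally show "cosh (c * t) ^ k \<le> 1 * exp (k * c\<^sup>2 / 2 * t\<^sup>2)" .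
qed simp_all

lemma gaussian_moments_exp:
  assumes M: "gaussian_moments M"
  shows "gaussian_moments (density M (\<lambda>t. ennreal (exp (s * t\<^sup>2))))"
  by (rule gaussian_moments_density[OF M, where B = 1 and c = s]) simp_all

lemma only_real_zeros_cosh:
  assumes M: "gaussian_moments M" and real: "only_real_zeros M" and "c \<ge> 0"
  shows "only_real_zeros (density M (\<lambda>t. ennreal (cosh (c * t))))"
  unfolding only_real_zeros_def
proof (intro allI impI)
  interpret even_real_zeros "\<lambda>z. entire_char M z / entire_char M 0"
    by (rule even_real_zeros_entire_char[OF M real])
  fix z assume "entire_char (density M (\<lambda>t. ennreal (cosh (c * t)))) z = 0"
  then have "entire_char M (z + \<i> * complex_of_real c) + entire_char M (z - \<i> * complex_of_real c) = 0"
    by (simp add: entire_char_density_cosh[OF gaussian_imp_exp_moments[OF M]])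
  then show "z \<in> \<real>"
    by (intro shift_average_real_zeros[OF \<open>c \<ge> 0\<close>]) (simp flip: add_divide_distrib)
qed

lemma only_real_zeros_cosh_power:
  assumes M: "gaussian_moments M" and real: "only_real_zeros M" and "c \<ge> 0"
  shows "only_real_zeros (density M (\<lambda>t. ennreal (cosh (c * t) ^ k)))"
proof (induction k)
  case 0
  show ?case using real by (simp add: density_1)
next
  case (Suc k)
  have [measurable_cong]: "sets M = sets borel" using M by (simp add: gaussian_moments_def)
  have [measurable]: "(\<lambda>t. cosh (c * t)) \<in> borel_measurable borel" unfolding cosh_def by measurable
  have eq: "density (density M (\<lambda>t. ennreal (cosh (c * t) ^ k))) (\<lambda>t. ennreal (cosh (c * t))) =
      density M (\<lambda>t. ennreal (cosh (c * t) ^ Suc k))"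
  proof (subst density_density_eq)
    show "(\<lambda>t. ennreal (cosh (c * t) ^ k)) \<in> borel_measurable M" by measurable
    show "(\<lambda>t. ennreal (cosh (c * t))) \<in> borel_measurable M" by measurable
  qed (simp add: mult.commute flip: ennreal_mult)
  show ?case
    using only_real_zeros_cosh[OF gaussian_moments_cosh_power[OF M] Suc \<open>c \<ge> 0\<close>] by (simp only: eq)
qed

text \<open>The weights \<open>cosh (c k * t) ^ Suc k\<close> preserve the reality of zeros and tend
  to \<open>exp (s t\<^sup>2)\<close> while staying below it. The transforms then converge locally
  uniformly, and Hurwitz's theorem applies.\<close>

lemma only_real_zeros_exp:
  assumes M: "gaussian_moments M" and real: "only_real_zeros M" and s: "s \<ge> 0"
  shows "only_real_zeros (density M (\<lambda>t. ennreal (exp (s * t\<^sup>2))))"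
  unfolding only_real_zeros_def
proof (intro allI impI)
  have sM [measurable_cong]: "sets M = sets borel" using M by (simp add: gaussian_moments_def)
  define c where "c k = sqrt (2 * s / real (Suc k))" for k
  define w where "w k t = cosh (c k * t) ^ Suc k" for k t
  have [measurable]: "w k \<in> borel_measurable borel" for k unfolding w_def cosh_def by measurable
  have w_pos: "0 \<le> w k t" for k t by (simp add: w_def)
  have w_le: "w k t \<le> exp (s * t\<^sup>2)" for k t
    unfolding w_def c_def by (rule cosh_scaled_power_le[OF s])
  have w_lim: "(\<lambda>k. w k t) \<longlonglongrightarrow> exp (s * t\<^sup>2)" for t
    unfolding w_def c_def by (rule cosh_scaled_power_limit[OF s])
  define F where "F k = entire_char (density M (\<lambda>t. ennreal (w k t)))" for k
  define G where "G = entire_char (density M (\<lambda>t. ennreal (exp (s * t\<^sup>2))))"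
  have F_eq: "F k z = (LINT t|M. exp (\<i> * z * complex_of_real t) * complex_of_real (w k t))" for k z
    unfolding F_def by (rule entire_char_density[OF sM]) (use w_pos in auto)
  have G_eq: "G z = (LINT t|M. exp (\<i> * z * complex_of_real t) * complex_of_real (exp (s * t\<^sup>2)))" for z
    unfolding G_def by (rule entire_char_density[OF sM]) auto
  have gm: "gaussian_moments (density M (\<lambda>t. ennreal (exp (s * t\<^sup>2))))"
    by (rule gaussian_moments_exp[OF M])
  have dom: "integrable M (\<lambda>t. exp (R * \<bar>t\<bar>) * exp (s * t\<^sup>2))" for R
  proof -
    have "integrable (density M (\<lambda>t. ennreal (exp (s * t\<^sup>2)))) (\<lambda>t. exp (R * \<bar>t\<bar>))"
      using gaussian_imp_exp_moments[OF gm] by (simp add: exp_moments_def)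
    then show ?thesis by (subst (asm) integrable_density) (auto simp: mult.commute)
  qed
  have int: "integrable M (\<lambda>t. exp (\<i> * z * complex_of_real t) * complex_of_real (v t))"
    if [measurable]: "v \<in> borel_measurable borel" and v: "\<And>t. 0 \<le> v t" "\<And>t. v t \<le> exp (s * t\<^sup>2)" for v z
  proof (rule Bochner_Integration.integrable_bound[OF dom[of "\<bar>Im z\<bar>"]])
    show "AE t in M. norm (exp (\<i> * z * complex_of_real t) * complex_of_real (v t))
        \<le> norm (exp (\<bar>Im z\<bar> * \<bar>t\<bar>) * exp (s * t\<^sup>2))"
      using norm_exp_i_mult_le v by (auto simp: norm_mult intro!: mult_mono)
  qed measurable
  \<comment> \<open>\<open>D R k\<close> bounds the difference of the two transforms simultaneously
    for all \<open>norm z \<le> R\<close>, so dominated convergence for this one real sequence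
    yields uniform convergence on compact sets.\<close>
  define D where "D R k = (LINT t|M. exp (R * \<bar>t\<bar>) * (exp (s * t\<^sup>2) - w k t))" for R k
  have D_int: "integrable M (\<lambda>t. exp (R * \<bar>t\<bar>) * (exp (s * t\<^sup>2) - w k t))" for R k
  proof (rule Bochner_Integration.integrable_bound[OF dom[of R]])
    show "AE t in M. norm (exp (R * \<bar>t\<bar>) * (exp (s * t\<^sup>2) - w k t)) \<le> norm (exp (R * \<bar>t\<bar>) * exp (s * t\<^sup>2))"
      using w_le w_pos by (auto simp: abs_mult)
  qed measurable
  have D_lim: "D R \<longlonglongrightarrow> 0" for R
  proof -
    have "D R \<longlonglongrightarrow> (LINT t|M. (0::real))"
      unfolding D_def
    proof (rule integral_dominated_convergence[OF _ _ dom[of R]])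
      show "AE t in M. (\<lambda>k. exp (R * \<bar>t\<bar>) * (exp (s * t\<^sup>2) - w k t)) \<longlonglongrightarrow> 0"
      proof (rule AE_I2)
        fix t
        have "(\<lambda>k. exp (R * \<bar>t\<bar>) * (exp (s * t\<^sup>2) - w k t)) \<longlonglongrightarrow> exp (R * \<bar>t\<bar>) * (exp (s * t\<^sup>2) - exp (s * t\<^sup>2))"
          by (intro tendsto_intros w_lim)
        then show "(\<lambda>k. exp (R * \<bar>t\<bar>) * (exp (s * t\<^sup>2) - w k t)) \<longlonglongrightarrow> 0" by simp
      qed
      show "AE t in M. norm (exp (R * \<bar>t\<bar>) * (exp (s * t\<^sup>2) - w k t)) \<le> exp (R * \<bar>t\<bar>) * exp (s * t\<^sup>2)" for k
        using w_le w_pos by (auto simp: abs_mult)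
    qed measurable
    then show ?thesis by simp
  qed
  have diff_le: "norm (F k z - G z) \<le> D R k" if "norm z \<le> R" for k z R
  proof -
    have "F k z - G z = (LINT t|M. exp (\<i> * z * complex_of_real t) * complex_of_real (w k t) -
        exp (\<i> * z * complex_of_real t) * complex_of_real (exp (s * t\<^sup>2)))"
      unfolding F_eq G_eq by (rule Bochner_Integration.integral_diff[symmetric]) (intro int; use w_le w_pos in auto)+
    also have "norm \<dots> \<le> D R k"
      unfolding D_def
    proof (rule Bochner_Integration.integral_norm_bound_integral[OF _ D_int])
      show "integrable M (\<lambda>t. exp (\<i> * z * complex_of_real t) * complex_of_real (w k t) -
        exp (\<i> * z * complex_of_real t) * complex_of_real (exp (s * t\<^sup>2)))"
        by (rule Bochner_Integration.integrable_diff) (intro int; use w_le w_pos in auto)+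
      fix t
      have "norm (exp (\<i> * z * complex_of_real t) * complex_of_real (w k t) -
          exp (\<i> * z * complex_of_real t) * complex_of_real (exp (s * t\<^sup>2))) =
          norm (exp (\<i> * z * complex_of_real t)) * (exp (s * t\<^sup>2) - w k t)"
        using w_le[of k t] unfolding right_diff_distrib[symmetric] norm_mult of_real_diff[symmetric] norm_of_real by simp
      also have "norm (exp (\<i> * z * complex_of_real t)) \<le> exp (R * \<bar>t\<bar>)"
      proof -
        have "\<bar>Im z\<bar> * \<bar>t\<bar> \<le> R * \<bar>t\<bar>"
          using that abs_Im_le_cmod[of z] by (intro mult_right_mono) auto
        with norm_exp_i_mult_le[of z t] show ?thesis by (meson exp_le_cancel_iff order_trans)
      qed
      finally show "norm (exp (\<i> * z * complex_of_real t) * complex_of_real (w k t) -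
          exp (\<i> * z * complex_of_real t) * complex_of_real (exp (s * t\<^sup>2))) \<le> exp (R * \<bar>t\<bar>) * (exp (s * t\<^sup>2) - w k t)"
        using w_le[of k t] by (simp add: mult_right_mono)
    qed
    finally show ?thesis .
  qed
  fix z assume "entire_char (density M (\<lambda>t. ennreal (exp (s * t\<^sup>2)))) z = 0"
  then have Gz: "G z = 0" by (simp add: G_def)
  have F_gm: "gaussian_moments (density M (\<lambda>t. ennreal (w k t)))" for k
    unfolding w_def by (rule gaussian_moments_cosh_power[OF M])
  have F_real: "only_real_zeros (density M (\<lambda>t. ennreal (w k t)))" for k
    unfolding w_def by (rule only_real_zeros_cosh_power[OF M real]) (use s in \<open>simp add: c_def\<close>)
  show "z \<in> \<real>"
  proof (rule Hurwitz_real_zeros[where F = F and g = G])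
    show "F k holomorphic_on UNIV" for k
      unfolding F_def by (intro entire_char_holomorphic gaussian_imp_exp_moments F_gm)
    show "G holomorphic_on UNIV"
      unfolding G_def by (intro entire_char_holomorphic gaussian_imp_exp_moments gm)
    show "w \<in> \<real>" if "F k w = 0" for k w
      using F_real[of k] that by (simp add: F_def only_real_zeros_def)
    show "G 0 \<noteq> 0"
      using gaussian_moments_measure_pos(2)[OF gm] by (simp add: G_def entire_char_0)
    show "uniform_limit K F G sequentially" if K: "compact K" for K
    proof -
      obtain R where R: "\<And>z. z \<in> K \<Longrightarrow> norm z \<le> R"
        using compact_imp_bounded[OF K] by (auto simp: bounded_iff)
      show ?thesis
      proof (rule uniform_limitI)
        fix e :: real assume "e > 0"
        with D_lim[of R] have "\<forall>\<^sub>F k in sequentially. D R k < e" by (rule order_tendstoD(2))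
        then show "\<forall>\<^sub>F k in sequentially. \<forall>z\<in>K. dist (F k z) (G z) < e"
        proof eventually_elim
          case (elim k)
          show ?case
          proof
            fix z assume "z \<in> K"
            with diff_le[OF R, of z k] elim show "dist (F k z) (G z) < e" unfolding dist_norm by linarith
          qed
        qed
      qed
    qed
  qed (rule Gz)
qed

text \<open>\<open>H \<rho> lam\<close> is the transform of the measure tilted by
  \<open>lam\<close>; the remaining tilt by \<open>b - lam \<ge> 0\<close> preserves the reality of
  zeros.\<close>

lemma only_real_zeros_of_P:
  assumes M: "gaussian_moments \<rho>" and lam: "lam \<in> \<P> \<rho>" and "lam \<le> b"
  shows "only_real_zeros (density \<rho> (\<lambda>t. ennreal (exp (b * t\<^sup>2))))"
proof -
  have sM [measurable_cong]: "sets \<rho> = sets borel" using M by (simp add: gaussian_moments_def)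
  have "only_real_zeros (density \<rho> (\<lambda>t. ennreal (exp (lam * t\<^sup>2))))"
    using lam by (simp add: only_real_zeros_def \<P>_def H_def entire_char_density[OF sM])
  from only_real_zeros_exp[OF gaussian_moments_exp[OF M] this, of "b - lam"] \<open>lam \<le> b\<close>
  have "only_real_zeros (density (density \<rho> (\<lambda>t. ennreal (exp (lam * t\<^sup>2)))) (\<lambda>t. ennreal (exp ((b - lam) * t\<^sup>2))))"
    by simp
  also have "density (density \<rho> (\<lambda>t. ennreal (exp (lam * t\<^sup>2)))) (\<lambda>t. ennreal (exp ((b - lam) * t\<^sup>2))) =
      density \<rho> (\<lambda>t. ennreal (exp (b * t\<^sup>2)))"
    by (subst density_density_eq) (auto simp: left_diff_distrib simp flip: ennreal_mult exp_add)
  finally show ?thesis .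
qed

text \<open>Normalising multiplies the transform by a positive constant, and rescaling replaces
  \<open>z\<close> by \<open>z / r\<close> with real \<open>r\<close>; neither affects whether the
  zeros are real.\<close>

lemma rescaled_tilt_properties:
  assumes M: "gaussian_moments \<rho>" and "r > 0"
  shows "real_distribution (rescaled_tilt \<rho> b r)" and "gaussian_moments (rescaled_tilt \<rho> b r)"
    and "only_real_zeros (density \<rho> (\<lambda>t. ennreal (exp (b * t\<^sup>2)))) \<Longrightarrow> only_real_zeros (rescaled_tilt \<rho> b r)"
proof -
  have sM [measurable_cong]: "sets \<rho> = sets borel" using M by (simp add: gaussian_moments_def)
  define K where "K = tilt_const \<rho> b"
  have int: "integrable \<rho> (\<lambda>t. exp (b * t\<^sup>2))" using M by (simp add: gaussian_moments_def)
  have "measure (density \<rho> (\<lambda>t. ennreal (exp (b * t\<^sup>2)))) UNIV > 0"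
    using gaussian_moments_measure_pos(2)[OF gaussian_moments_exp[OF M, of b]] sets_eq_imp_space_eq[OF sM] by simp
  \<comment> \<open>The normalising integral is identified with the total mass of the tilted measure
    by evaluating the transform at 0; this shows that it is positive.\<close>
  moreover have "complex_of_real (measure (density \<rho> (\<lambda>t. ennreal (exp (b * t\<^sup>2)))) UNIV) = complex_of_real (LINT t|\<rho>. exp (b * t\<^sup>2))"
    using entire_char_0[of "density \<rho> (\<lambda>t. ennreal (exp (b * t\<^sup>2)))"] sets_eq_imp_space_eq[OF sM]
    by (simp add: entire_char_density[OF sM])
  ultimately have I: "(LINT t|\<rho>. exp (b * t\<^sup>2)) > 0" by (simp only: of_real_eq_iff)
  then have K: "K > 0" by (simp add: K_def tilt_const_def)
  define T where "T = density \<rho> (\<lambda>t. ennreal (K * exp (b * t\<^sup>2)))"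
  have T: "gaussian_moments T"
    unfolding T_def by (rule gaussian_moments_density[OF M, where B = K and c = b]) (use K in auto)
  have sT [measurable_cong]: "sets T = sets borel" using T by (simp add: gaussian_moments_def)
  have R: "rescaled_tilt \<rho> b r = distr T borel (\<lambda>t. t / r)"
    by (simp add: rescaled_tilt_def T_def K_def)
  have prob: "prob_space T"
  proof
    have "emeasure T (space T) = (\<integral>\<^sup>+ t. ennreal (K * exp (b * t\<^sup>2)) \<partial>\<rho>)"
      unfolding T_def by (subst emeasure_density) auto
    also have "\<dots> = ennreal (LINT t|\<rho>. K * exp (b * t\<^sup>2))"
      using int K by (intro nn_integral_eq_integral) auto
    also have "(LINT t|\<rho>. K * exp (b * t\<^sup>2)) = 1" using I by (simp add: K_def tilt_const_def)
    finally show "emeasure T (space T) = 1" by simp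
  qed
  interpret D: prob_space "distr T borel (\<lambda>t. t / r)"
    by (rule prob_space.prob_space_distr[OF prob]) measurable
  show "real_distribution (rescaled_tilt \<rho> b r)"
    unfolding R by unfold_locales simp
  show "gaussian_moments (rescaled_tilt \<rho> b r)"
    unfolding R gaussian_moments_def
  proof (intro conjI allI)
    have "distr (distr T borel (\<lambda>t. t / r)) borel uminus = distr (distr T borel uminus) borel (\<lambda>t. t / r)"
      by (simp add: distr_distr o_def)
    then show "even_measure (distr T borel (\<lambda>t. t / r))"
      using T by (simp add: even_measure_def gaussian_moments_def)
    show "emeasure (distr T borel (\<lambda>t. t / r)) UNIV > 0"
      using D.emeasure_space_1 by simp
    show "integrable (distr T borel (\<lambda>t. t / r)) (\<lambda>t. exp (a * t\<^sup>2))" for a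
    proof (subst integrable_distr_eq)
      have "integrable T (\<lambda>t. exp (a / r\<^sup>2 * t\<^sup>2))" using T unfolding gaussian_moments_def by blast
      then show "integrable T (\<lambda>t. exp (a * (t / r)\<^sup>2))" by (simp add: power_divide)
    qed measurable
  qed simp
  assume real: "only_real_zeros (density \<rho> (\<lambda>t. ennreal (exp (b * t\<^sup>2))))"
  show "only_real_zeros (rescaled_tilt \<rho> b r)"
    unfolding only_real_zeros_def
  proof (intro allI impI)
    fix z assume z: "entire_char (rescaled_tilt \<rho> b r) z = 0"
    have "entire_char (rescaled_tilt \<rho> b r) z = entire_char T (z / r)"
      unfolding entire_char_def R by (subst integral_distr) (auto simp: mult_ac)
    also have "\<dots> = (LINT t|\<rho>. exp (\<i> * (z / r) * complex_of_real t) * complex_of_real (K * exp (b * t\<^sup>2)))"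
      unfolding T_def by (rule entire_char_density[OF sM]) (use K in auto)
    also have "\<dots> = (LINT t|\<rho>. complex_of_real K * (exp (\<i> * (z / r) * complex_of_real t) * complex_of_real (exp (b * t\<^sup>2))))"
      by (intro Bochner_Integration.integral_cong) auto
    also have "\<dots> = K * entire_char (density \<rho> (\<lambda>t. ennreal (exp (b * t\<^sup>2)))) (z / r)"
      by (simp add: entire_char_density[OF sM])
    finally have "entire_char (density \<rho> (\<lambda>t. ennreal (exp (b * t\<^sup>2)))) (z / r) = 0" using z K by simp
    then have "z / r \<in> \<real>" using real by (simp add: only_real_zeros_def)
    then have "z / r * r \<in> \<real>" by (intro Reals_mult) auto
    then show "z \<in> \<real>" using \<open>r > 0\<close> by simp
  qed
qed

section \<open>Weak limits\<close>

text \<open>The real part is the integral of \<open>cos (t x)\<close>, and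
  \<open>1 - cos (t x)\<close> lies below the truncated square for all
  \<open>\<bar>t\<bar> \<le> d\<close>.\<close>

lemma half_le_norm_entire_char:
  assumes M: "real_distribution M" and E: "exp_moments M"
    and small: "(LINT x|M. min 2 ((d * x)\<^sup>2 / 2)) \<le> 1 / 2" and t: "\<bar>t\<bar> \<le> d"
  shows "1 / 2 \<le> norm (entire_char M (complex_of_real t))"
proof -
  interpret real_distribution M by fact
  have int: "integrable M (\<lambda>x. min 2 ((d * x)\<^sup>2 / 2))"
    by (rule integrable_const_bound[where B = 2]) (auto simp: min_def)
  have cos_int: "integrable M (\<lambda>x. cos (t * x))"
    by (rule integrable_const_bound[where B = 1]) auto
  have "1 - (LINT x|M. cos (t * x)) = (LINT x|M. 1 - cos (t * x))"
    using cos_int by (simp add: prob_space[simplified])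
  also have "\<dots> \<le> (LINT x|M. min 2 ((d * x)\<^sup>2 / 2))"
  proof (rule integral_mono)
    fix x
    have "\<bar>t * x\<bar> \<le> \<bar>d * x\<bar>" using t by (auto simp: abs_mult intro!: mult_right_mono)
    then have "(t * x)\<^sup>2 \<le> (d * x)\<^sup>2" by (rule abs_le_square_iff[THEN iffD1])
    then show "1 - cos (t * x) \<le> min 2 ((d * x)\<^sup>2 / 2)" using one_minus_cos_le[of "t * x"] by linarith
  qed (use int cos_int in auto)
  also have "\<dots> \<le> 1 / 2" by (rule small)
  finally have "1 / 2 \<le> (LINT x|M. cos (t * x))" by simp
  also have "\<dots> = Re (entire_char M (complex_of_real t))"
  proof -
    have "Re (exp (\<i> * complex_of_real t * complex_of_real x)) = cos (t * x)" for x by (simp add: Re_exp)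
    then show ?thesis
      unfolding entire_char_def by (subst integral_Re[OF exp_moments_integrable[OF E], symmetric]) simp
  qed
  also have "\<dots> \<le> norm (entire_char M (complex_of_real t))" by (rule complex_Re_le_cmod)
  finally show ?thesis .
qed

text \<open>The modulus at \<open>d\<close> is at least 1/2, so
  \<open>norm_imaginary_axis_le\<close> bounds the value at \<open>\<i> s\<close> by 2 to the power
  \<open>s\<^sup>2 / d\<^sup>2\<close>. The constant depends on the measure through \<open>d\<close>
  alone, which makes the estimate uniform along a sequence.\<close>

lemma integral_cosh_le:
  assumes M: "real_distribution M" and G: "gaussian_moments M" and real: "only_real_zeros M" and "d > 0"
    and small: "(LINT x|M. min 2 ((d * x)\<^sup>2 / 2)) \<le> 1 / 2"
  shows "(LINT x|M. cosh (s * x)) \<le> exp (ln 2 / d\<^sup>2 * s\<^sup>2)"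
proof -
  interpret real_distribution M by fact
  have E: "exp_moments M" using G by (rule gaussian_imp_exp_moments)
  have [measurable]: "(\<lambda>x. cosh (s * x)) \<in> borel_measurable borel" unfolding cosh_def by measurable
  have e0: "entire_char M 0 = 1" by (simp add: entire_char_0 prob_space[simplified])
  interpret even_real_zeros "\<lambda>z. entire_char M z / entire_char M 0"
    by (rule even_real_zeros_entire_char[OF G real])
  have half: "1 / 2 \<le> norm (entire_char M (complex_of_real t))" if "\<bar>t\<bar> \<le> d" for t
    by (rule half_le_norm_entire_char[OF M E small that])
  have "(LINT x|M. cosh (s * x)) \<le> norm (complex_of_real (LINT x|M. cosh (s * x)))"
    by simp
  \<comment> \<open>At the origin the transform of the weighted measure is the mean of the values at
    \<open>\<i> s\<close> and \<open>- \<i> s\<close>, which coincide by evenness.\<close>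
  also have "complex_of_real (LINT x|M. cosh (s * x)) = entire_char (density M (\<lambda>t. ennreal (cosh (s * t)))) 0"
    by (subst entire_char_density) simp_all
  also have "\<dots> = entire_char M (\<i> * complex_of_real s)"
    using entire_char_even[of M "\<i> * complex_of_real s"] G
    by (simp add: entire_char_density_cosh[OF E] gaussian_moments_def)
  also have "norm \<dots> \<le> norm (entire_char M (complex_of_real d)) powr (- (s\<^sup>2 / d\<^sup>2))"
    using norm_imaginary_axis_le[of d s] \<open>d > 0\<close> half by (force simp: e0)
  also have "\<dots> \<le> (1 / 2) powr (- (s\<^sup>2 / d\<^sup>2))"
    using half[of d] \<open>d > 0\<close> by (intro powr_mono2') auto
  also have "\<dots> = exp (ln 2 / d\<^sup>2 * s\<^sup>2)"
    by (simp add: powr_def ln_div)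
  finally show ?thesis .
qed

lemma exp_le_2_cosh: "exp \<bar>x\<bar> \<le> 2 * cosh x" for x :: real
proof -
  have "exp \<bar>x\<bar> \<le> 2 * cosh \<bar>x\<bar>" unfolding cosh_field_def by simp
  then show ?thesis by simp
qed

text \<open>A discrete form of Gaussian averaging over \<open>s\<close>:
  \<open>exp (b x\<^sup>2)\<close> is dominated by a series of weighted functions
  \<open>cosh (2 b k x)\<close>, whose integrals are controlled by the hypothesis.\<close>

lemma subgaussian_imp_gaussian_moment:
  assumes [measurable_cong]: "sets M = sets borel" and "C > 0"
    and cosh_le: "\<And>s. (\<integral>\<^sup>+ x. ennreal (cosh (s * x)) \<partial>M) \<le> ennreal (exp (C * s\<^sup>2))"
  shows "(\<integral>\<^sup>+ x. ennreal (exp (1 / (8 * C) * x\<^sup>2)) \<partial>M) < \<infinity>"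
proof -
  \<comment> \<open>With this value \<open>C * (2 b k)\<^sup>2 = b k\<^sup>2 / 2\<close>, half of
    the decay in the weight \<open>a k\<close>; what remains, together with
    \<open>k \<le> k\<^sup>2\<close>, leaves a convergent geometric series.\<close>
  define b where "b = 1 / (8 * C)"
  have b: "b > 0" using \<open>C > 0\<close> by (simp add: b_def)
  define a where "a k = 2 * exp (b - b * (real k)\<^sup>2)" for k
  have a: "a k > 0" for k by (simp add: a_def)
  have [measurable]: "(\<lambda>x. cosh (c * x)) \<in> borel_measurable borel" for c :: real unfolding cosh_def by measurable
  \<comment> \<open>The term with \<open>k\<close> the integer part of \<open>|x|\<close> already dominates, as \<open>b (|x| - k)^2 \<le> b\<close>.\<close>
  have "ennreal (exp (b * x\<^sup>2)) \<le> (\<Sum>k. ennreal (a k * cosh (2 * b * real k * x)))" for x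
  proof -
    define k where "k = nat \<lfloor>\<bar>x\<bar>\<rfloor>"
    have k: "real k \<le> \<bar>x\<bar>" "\<bar>x\<bar> < real k + 1" by (auto simp: k_def)
    have "(\<bar>x\<bar> - real k)\<^sup>2 \<le> 1" using k by (intro power_le_one) auto
    then have "b * (\<bar>x\<bar> - real k)\<^sup>2 \<le> b" using b by simp
    moreover have "b * x\<^sup>2 = b * (\<bar>x\<bar> - real k)\<^sup>2 + (2 * b * real k * \<bar>x\<bar> - b * (real k)\<^sup>2)"
      by (simp add: power2_diff algebra_simps)
    ultimately have "exp (b * x\<^sup>2) \<le> exp ((b - b * (real k)\<^sup>2) + \<bar>2 * b * real k * x\<bar>)"
      using b by (simp add: abs_mult)
    also have "\<dots> = exp (b - b * (real k)\<^sup>2) * exp \<bar>2 * b * real k * x\<bar>" by (rule exp_add)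
    also have "\<dots> \<le> a k * cosh (2 * b * real k * x)"
      unfolding a_def using mult_left_mono[OF exp_le_2_cosh[of "2 * b * real k * x"], of "exp (b - b * (real k)\<^sup>2)"]
      by (simp add: mult_ac)
    finally have "ennreal (exp (b * x\<^sup>2)) \<le> ennreal (a k * cosh (2 * b * real k * x))" by (rule ennreal_leI)
    also have "\<dots> = (\<Sum>k\<in>{k}. ennreal (a k * cosh (2 * b * real k * x)))" by simp
    also have "\<dots> \<le> (\<Sum>k. ennreal (a k * cosh (2 * b * real k * x)))"
      by (rule sum_le_suminf) auto
    finally show ?thesis .
  qed
  then have "(\<integral>\<^sup>+ x. ennreal (exp (b * x\<^sup>2)) \<partial>M) \<le> (\<integral>\<^sup>+ x. (\<Sum>k. ennreal (a k * cosh (2 * b * real k * x))) \<partial>M)"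
    by (rule nn_integral_mono)
  also have "\<dots> = (\<Sum>k. \<integral>\<^sup>+ x. ennreal (a k * cosh (2 * b * real k * x)) \<partial>M)"
    by (rule nn_integral_suminf) measurable
  also have "\<dots> \<le> (\<Sum>k. ennreal (2 * exp b * exp (- b / 2) ^ k))"
  proof (rule suminf_le)
    fix k
    have "(\<integral>\<^sup>+ x. ennreal (a k * cosh (2 * b * real k * x)) \<partial>M) = ennreal (a k) * (\<integral>\<^sup>+ x. ennreal (cosh (2 * b * real k * x)) \<partial>M)"
      using a[of k] by (subst nn_integral_cmult[symmetric]) (auto simp: ennreal_mult less_imp_le)
    also have "\<dots> \<le> ennreal (a k) * ennreal (exp (C * (2 * b * real k)\<^sup>2))"
      by (intro mult_left_mono cosh_le) auto
    also have "\<dots> = ennreal (a k * exp (C * (2 * b * real k)\<^sup>2))"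
      using a[of k] by (simp add: ennreal_mult less_imp_le)
    also have "a k * exp (C * (2 * b * real k)\<^sup>2) = 2 * exp (b - b * (real k)\<^sup>2 / 2)"
    proof -
      have "C * (2 * b * real k)\<^sup>2 = b * (real k)\<^sup>2 / 2"
        using \<open>C > 0\<close> by (simp add: b_def power2_eq_square)
      then show ?thesis by (simp add: a_def flip: exp_add)
    qed
    also have "\<dots> \<le> 2 * exp b * exp (- b / 2) ^ k"
    proof -
      have "real k \<le> (real k)\<^sup>2"
        using of_nat_mono[OF le_square[of k], where 'a = real] by (simp add: power2_eq_square)
      then have "b - b * (real k)\<^sup>2 / 2 \<le> b + real k * (- b / 2)" using b by simp
      then show ?thesis by (simp flip: exp_add exp_of_nat_mult)
    qed
    finally show "(\<integral>\<^sup>+ x. ennreal (a k * cosh (2 * b * real k * x)) \<partial>M) \<le> ennreal (2 * exp b * exp (- b / 2) ^ k)"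
      by (simp add: ennreal_leI)
  qed auto
  also have "\<dots> < \<infinity>"
  proof -
    have "summable (\<lambda>k. 2 * exp b * exp (- b / 2) ^ k)"
      using b by (intro summable_mult summable_geometric) simp
    then show ?thesis by (subst suminf_ennreal2) auto
  qed
  finally show ?thesis unfolding b_def .
qed

text \<open>Since \<open>cosh\<close> is unbounded, weak convergence is used for its truncations at
  \<open>m\<close>, and monotone convergence in \<open>m\<close> removes the truncation.\<close>

lemma nn_integral_cosh_weak_limit_le:
  assumes \<nu>: "\<And>n. real_distribution (\<nu> n)" and \<mu>: "real_distribution \<mu>" and conv: "weak_conv_m \<nu> \<mu>"
    and int: "\<And>n. integrable (\<nu> n) (\<lambda>x. cosh (s * x))" and le: "\<And>n. (LINT x|\<nu> n. cosh (s * x)) \<le> B"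
  shows "(\<integral>\<^sup>+ x. ennreal (cosh (s * x)) \<partial>\<mu>) \<le> ennreal B"
proof -
  interpret \<mu>: real_distribution \<mu> by fact
  have cont: "isCont (\<lambda>x. min (cosh (s * x)) (real m)) x" for m x by (intro continuous_intros)
  have [measurable]: "(\<lambda>x. cosh (s * x)) \<in> borel_measurable borel" unfolding cosh_def by measurable
  have bound: "(\<integral>\<^sup>+ x. ennreal (min (cosh (s * x)) (real m)) \<partial>\<mu>) \<le> ennreal B" for m
  proof -
    have nb: "norm (min (cosh (s * x)) (real m)) \<le> real m" for x
      by (simp add: min_def)
    have "(\<lambda>n. LINT x|\<nu> n. min (cosh (s * x)) (real m)) \<longlonglongrightarrow> (LINT x|\<mu>. min (cosh (s * x)) (real m))"
      by (rule weak_conv_imp_integral_bdd_continuous_conv[OF \<nu> \<mu> conv cont nb])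
    moreover have "(LINT x|\<nu> n. min (cosh (s * x)) (real m)) \<le> B" for n
    proof -
      interpret \<nu>: real_distribution "\<nu> n" by fact
      have "(LINT x|\<nu> n. min (cosh (s * x)) (real m)) \<le> (LINT x|\<nu> n. cosh (s * x))"
        by (intro integral_mono int \<nu>.integrable_const_bound[where B = "real m"]) (use nb in auto)
      with le[of n] show ?thesis by linarith
    qed
    ultimately have "(LINT x|\<mu>. min (cosh (s * x)) (real m)) \<le> B"
      by (auto intro: LIMSEQ_le_const2)
    moreover have "(\<integral>\<^sup>+ x. ennreal (min (cosh (s * x)) (real m)) \<partial>\<mu>) = ennreal (LINT x|\<mu>. min (cosh (s * x)) (real m))"
      by (intro nn_integral_eq_integral \<mu>.integrable_const_bound[where B = "real m"]) (use nb in auto)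
    ultimately show ?thesis by (simp add: ennreal_leI)
  qed
  have "(\<lambda>m. \<integral>\<^sup>+ x. ennreal (min (cosh (s * x)) (real m)) \<partial>\<mu>) \<longlonglongrightarrow> (\<integral>\<^sup>+ x. ennreal (cosh (s * x)) \<partial>\<mu>)"
  proof (rule nn_integral_LIMSEQ)
    show "incseq (\<lambda>m x. ennreal (min (cosh (s * x)) (real m)))"
      by (auto simp: incseq_def le_fun_def intro!: ennreal_leI)
    show "(\<lambda>m. ennreal (min (cosh (s * x)) (real m))) \<longlonglongrightarrow> ennreal (cosh (s * x))" for x
    proof (rule tendsto_eventually)
      obtain N :: nat where "cosh (s * x) \<le> real N" using real_arch_simple by blast
      then show "\<forall>\<^sub>F m in sequentially. ennreal (min (cosh (s * x)) (real m)) = ennreal (cosh (s * x))"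
        by (intro eventually_sequentiallyI[of N]) (auto simp: min_def)
    qed
  qed measurable
  then show ?thesis
    by (rule LIMSEQ_le_const2) (use bound in auto)
qed

lemma cosh_integrable:
  assumes "exp_moments M"
  shows "integrable M (\<lambda>x. cosh (s * x))"
proof -
  have [measurable_cong]: "sets M = sets borel" using assms by (simp add: exp_moments_def)
  have "integrable M (\<lambda>x. exp (\<bar>s\<bar> * \<bar>x\<bar>))" using assms by (simp add: exp_moments_def)
  then show ?thesis
  proof (rule Bochner_Integration.integrable_bound)
    show "(\<lambda>x. cosh (s * x)) \<in> borel_measurable M" unfolding cosh_def by measurable
    have "cosh (s * x) \<le> exp (\<bar>s\<bar> * \<bar>x\<bar>)" for x
    proof -
      have "0 \<le> sinh \<bar>s * x\<bar>" by simp
      then have "cosh \<bar>s * x\<bar> \<le> exp \<bar>s * x\<bar>" using sinh_plus_cosh[of "\<bar>s * x\<bar>"] by linarith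
      then show ?thesis using cosh_real_abs[of "s * x"] by (simp only: abs_mult)
    qed
    then show "AE x in M. norm (cosh (s * x)) \<le> norm (exp (\<bar>s\<bar> * \<bar>x\<bar>))" by simp
  qed
qed

lemma weak_limit_in_X:
  fixes \<nu> :: "nat \<Rightarrow> real measure"
  assumes \<nu>: "\<And>n. real_distribution (\<nu> n)" and G: "\<And>n. gaussian_moments (\<nu> n)"
    and real: "\<And>n. only_real_zeros (\<nu> n)"
    and \<mu>: "real_distribution \<mu>" and conv: "weak_conv_m \<nu> \<mu>"
    and "d > 0" and small: "\<And>n. (LINT x|\<nu> n. min 2 ((d * x)\<^sup>2 / 2)) \<le> 1 / 2"
  shows "\<mu> \<in> \<X>"
proof -
  interpret \<mu>: real_distribution \<mu> by fact
  have E: "exp_moments (\<nu> n)" for n by (rule gaussian_imp_exp_moments[OF G])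
  \<comment> \<open>One sub-Gaussian constant for all \<open>\<nu> n\<close>; it serves both the
    moment of the limit and the local bounds for the normal family.\<close>
  define C where "C = ln 2 / d\<^sup>2"
  have C: "C > 0" using \<open>d > 0\<close> by (simp add: C_def)
  have \<nu>_cosh: "(LINT x|\<nu> n. cosh (s * x)) \<le> exp (C * s\<^sup>2)" for n s
    unfolding C_def by (rule integral_cosh_le[OF \<nu> G real \<open>d > 0\<close> small])
  have \<mu>_cosh: "(\<integral>\<^sup>+ x. ennreal (cosh (s * x)) \<partial>\<mu>) \<le> ennreal (exp (C * s\<^sup>2))" for s
    by (rule nn_integral_cosh_weak_limit_le[OF \<nu> \<mu> conv cosh_integrable[OF E] \<nu>_cosh])
  have \<mu>_E: "exp_moments \<mu>"
    unfolding exp_moments_def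
  proof (intro conjI allI)
    fix s :: real
    have [measurable]: "(\<lambda>x. cosh (s * x)) \<in> borel_measurable borel" unfolding cosh_def by measurable
    have "integrable \<mu> (\<lambda>x. cosh (s * x))"
      using \<mu>_cosh[of s] by (intro integrableI_nonneg) (auto simp: le_less_trans)
    then have "integrable \<mu> (\<lambda>x. 2 * cosh (s * x))" by simp
    then show "integrable \<mu> (\<lambda>x. exp (s * \<bar>x\<bar>))"
    proof (rule Bochner_Integration.integrable_bound)
      have "exp (s * \<bar>x\<bar>) \<le> exp \<bar>s * x\<bar>" for x by (simp add: abs_mult mult_right_mono)
      then have "exp (s * \<bar>x\<bar>) \<le> 2 * cosh (s * x)" for x
        using exp_le_2_cosh[of "s * x"] order_trans by blast
      then show "AE x in \<mu>. norm (exp (s * \<bar>x\<bar>)) \<le> norm (2 * cosh (s * x))" by simp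
    qed measurable
  qed simp
  have char: "entire_char M (complex_of_real t) = char M t" for M t
    by (simp add: entire_char_def char_def mult_ac)
  have char_conv: "(\<lambda>n. char (\<nu> n) t) \<longlonglongrightarrow> char \<mu> t" for t
    by (rule levy_continuity1[OF \<nu> \<mu> conv])
  \<comment> \<open>Evenness is read off the characteristic function, whose symmetry passes to
    pointwise limits, and returns to the measure by Levy's uniqueness theorem.\<close>
  have even: "even_measure \<mu>"
    unfolding even_measure_def
  proof (rule Levy_uniqueness)
    interpret D: prob_space "distr \<mu> borel uminus" by (rule \<mu>.prob_space_distr) measurable
    show "real_distribution (distr \<mu> borel uminus)" by unfold_locales simp
    show "char (distr \<mu> borel uminus) = char \<mu>"
    proof
      fix t
      have "char (\<nu> n) (- t) = char (\<nu> n) t" for n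
        using entire_char_even[of "\<nu> n" "complex_of_real t"] G[of n]
          char[of "\<nu> n" t] char[of "\<nu> n" "- t"] by (simp add: gaussian_moments_def)
      then have "(\<lambda>n. char (\<nu> n) t) \<longlonglongrightarrow> char \<mu> (- t)"
        using char_conv[of "- t"] by simp
      then have "char \<mu> (- t) = char \<mu> t"
        using char_conv[of t] by (rule LIMSEQ_unique)
      moreover have "char (distr \<mu> borel uminus) t = char \<mu> (- t)"
        unfolding char_def by (subst integral_distr) simp_all
      ultimately show "char (distr \<mu> borel uminus) t = char \<mu> t" by simp
    qed
  qed (rule \<mu>)
  have norm_le: "norm (entire_char (\<nu> n) z) \<le> 2 * exp (C * (norm z)\<^sup>2)" for n z
  proof -
    have "norm (entire_char (\<nu> n) z) \<le> (LINT x|\<nu> n. exp (norm z * \<bar>x\<bar>))"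
      by (rule norm_entire_char_le[OF E abs_Im_le_cmod])
    also have "\<dots> \<le> (LINT x|\<nu> n. 2 * cosh (norm z * x))"
    proof (rule integral_mono)
      show "integrable (\<nu> n) (\<lambda>x. exp (norm z * \<bar>x\<bar>))" using E[of n] by (simp add: exp_moments_def)
      show "exp (norm z * \<bar>x\<bar>) \<le> 2 * cosh (norm z * x)" for x
        using exp_le_2_cosh[of "norm z * x"] by (simp add: abs_mult)
    qed (simp add: cosh_integrable[OF E])
    also have "\<dots> \<le> 2 * exp (C * (norm z)\<^sup>2)" using \<nu>_cosh[of n "norm z"] by simp
    finally show ?thesis .
  qed
  have locally_bounded: "\<exists>B. \<forall>h\<in>range (\<lambda>n. entire_char (\<nu> n)). \<forall>z\<in>K. norm (h z) \<le> B" if K: "compact K" for K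
  proof -
    obtain R where R: "\<And>z. z \<in> K \<Longrightarrow> norm z \<le> R"
      using compact_imp_bounded[OF K] by (auto simp: bounded_iff)
    have "norm (entire_char (\<nu> n) z) \<le> 2 * exp (C * R\<^sup>2)" if "z \<in> K" for n z
    proof -
      have "C * (norm z)\<^sup>2 \<le> C * R\<^sup>2" using R[OF that] C by (intro mult_left_mono power_mono) auto
      then have "2 * exp (C * (norm z)\<^sup>2) \<le> 2 * exp (C * R\<^sup>2)" by simp
      with norm_le[of n z] show ?thesis by (rule order_trans)
    qed
    then show ?thesis by blast
  qed
  have holo: "h holomorphic_on UNIV" if "h \<in> range (\<lambda>n. entire_char (\<nu> n))" for h
    using that entire_char_holomorphic[OF E] by auto
  obtain g r where g: "g holomorphic_on UNIV" and r: "strict_mono (r :: nat \<Rightarrow> nat)"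
    and lim': "\<And>z. z \<in> UNIV \<Longrightarrow> (\<lambda>n. entire_char (\<nu> (r n)) z) \<longlonglongrightarrow> g z"
    and unif': "\<And>K. compact K \<Longrightarrow> K \<subseteq> UNIV \<Longrightarrow> uniform_limit K ((\<lambda>n. entire_char (\<nu> n)) \<circ> r) g sequentially"
    using Montel[OF open_UNIV holo locally_bounded order_refl] by blast
  note lim = lim'[OF UNIV_I] and unif = unif'[OF _ subset_UNIV]
  \<comment> \<open>Weak convergence identifies the subsequential limit on the real line; as the
    reals accumulate at 0, the identity theorem extends this to the plane.\<close>
  have g_eq: "g z = entire_char \<mu> z" for z
  proof -
    have "g z - entire_char \<mu> z = 0"
    proof (rule analytic_continuation[of "\<lambda>z. g z - entire_char \<mu> z" UNIV \<real> 0])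
      show "(\<lambda>z. g z - entire_char \<mu> z) holomorphic_on UNIV"
        using g entire_char_holomorphic[OF \<mu>_E] by (intro holomorphic_intros)
      show "0 islimpt (\<real> :: complex set)"
        unfolding islimpt_approachable
      proof (intro allI impI)
        fix e :: real assume "e > 0"
        then show "\<exists>x'\<in>\<real>. x' \<noteq> 0 \<and> dist x' (0 :: complex) < e"
          by (intro bexI[of _ "complex_of_real (e / 2)"]) (auto simp: norm_divide)
      qed
      show "g w - entire_char \<mu> w = 0" if w: "w \<in> \<real>" for w
      proof -
        obtain t where t: "w = complex_of_real t" using w by (rule Reals_cases)
        have "(\<lambda>n. char (\<nu> (r n)) t) \<longlonglongrightarrow> char \<mu> t"
          using LIMSEQ_subseq_LIMSEQ[OF char_conv[of t] r] by (simp add: o_def)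
        moreover have "(\<lambda>n. char (\<nu> (r n)) t) \<longlonglongrightarrow> g w"
          using lim[of w] by (simp add: t char)
        ultimately have "char \<mu> t = g w" by (rule LIMSEQ_unique)
        then show ?thesis by (simp add: t char)
      qed
    qed auto
    then show ?thesis by simp
  qed
  have real_zeros: "z \<in> \<real>" if "entire_char \<mu> z = 0" for z
  proof (rule Hurwitz_real_zeros[OF _ g unif])
    show "((\<lambda>n. entire_char (\<nu> n)) \<circ> r) n holomorphic_on UNIV" for n
      using entire_char_holomorphic[OF E] by simp
    show "w \<in> \<real>" if "((\<lambda>n. entire_char (\<nu> n)) \<circ> r) n w = 0" for n w
      using real that by (simp add: only_real_zeros_def)
    show "g 0 \<noteq> 0" by (simp add: g_eq entire_char_0 \<mu>.prob_space[simplified])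
    show "g z = 0" using that by (simp add: g_eq)
  qed
  have "(\<integral>\<^sup>+ x. ennreal (exp (1 / (8 * C) * x\<^sup>2)) \<partial>\<mu>) < \<infinity>"
    by (rule subgaussian_imp_gaussian_moment[OF _ C \<mu>_cosh]) simp
  then have "\<exists>b>0. (\<integral>\<^sup>+ x. ennreal (exp (b * x\<^sup>2)) \<partial>\<mu>) < \<infinity>"
    using C by (intro exI[of _ "1 / (8 * C)"]) simp
  then show ?thesis
    using \<mu> even real_zeros by (simp add: \<X>_def entire_char_def)
qed

text \<open>Dominated convergence along \<open>d = 1 / (k + 1)\<close>, with the truncation level 2
  as dominating function.\<close>

lemma truncated_second_moment_small:
  assumes "real_distribution \<mu>"
  obtains d where "d > 0" "(LINT x|\<mu>. min 2 ((d * x)\<^sup>2 / 2)) < 1 / 2"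
proof -
  interpret real_distribution \<mu> by fact
  have "(\<lambda>k. LINT x|\<mu>. min 2 ((1 / real (Suc k) * x)\<^sup>2 / 2)) \<longlonglongrightarrow> (LINT x|\<mu>. 0)"
  proof (rule integral_dominated_convergence[where w = "\<lambda>_. 2"])
    show "AE x in \<mu>. (\<lambda>k. min 2 ((1 / real (Suc k) * x)\<^sup>2 / 2)) \<longlonglongrightarrow> 0"
    proof (rule AE_I2)
      fix x
      have "(\<lambda>k. 1 / real (Suc k)) \<longlonglongrightarrow> 0" by real_asymp
      then have "(\<lambda>k. min 2 ((1 / real (Suc k) * x)\<^sup>2 / 2)) \<longlonglongrightarrow> min 2 ((0 * x)\<^sup>2 / 2)"
        by (intro tendsto_intros) auto
      then show "(\<lambda>k. min 2 ((1 / real (Suc k) * x)\<^sup>2 / 2)) \<longlonglongrightarrow> 0" by simp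
    qed
  qed (auto simp: min_def)
  then have "\<forall>\<^sub>F k in sequentially. (LINT x|\<mu>. min 2 ((1 / real (Suc k) * x)\<^sup>2 / 2)) < 1 / 2"
    by (intro order_tendstoD(2)) auto
  then obtain k where "(LINT x|\<mu>. min 2 ((1 / real (Suc k) * x)\<^sup>2 / 2)) < 1 / 2"
    by (auto dest: eventually_happens)
  then show ?thesis by (intro that[of "1 / real (Suc k)"]) auto
qed

theorem proposition19:
  fixes \<rho> \<mu> :: "real measure" and b r :: "nat \<Rightarrow> real"
  assumes "finite_measure \<rho>" and "sets \<rho> = sets borel"
    and "even_measure \<rho>" and "0 < emeasure \<rho> UNIV"
    and "\<T> \<rho> = UNIV"
    and "\<And>n. 0 < b n" and "filterlim b at_top sequentially"
    and "\<And>n. 0 < r n"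
    and "real_distribution \<mu>"
    and "weak_conv_m (\<lambda>n. rescaled_tilt \<rho> (b n) (r n)) \<mu>"
    and "\<mu> \<notin> \<X>"
  shows "\<P> \<rho> = {}"
proof (rule ccontr)
  assume "\<P> \<rho> \<noteq> {}"
  then obtain lam where lam: "lam \<in> \<P> \<rho>" by blast
  have [measurable_cong]: "sets \<rho> = sets borel" by fact
  have G: "gaussian_moments \<rho>"
    unfolding gaussian_moments_def
  proof (intro conjI allI)
    fix a
    have "(\<integral>\<^sup>+ x. ennreal (exp (a * x\<^sup>2)) \<partial>\<rho>) < \<infinity>" using \<open>\<T> \<rho> = UNIV\<close> by (auto simp: \<T>_def)
    then show "integrable \<rho> (\<lambda>t. exp (a * t\<^sup>2))" by (intro integrableI_nonneg) auto
  qed fact+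
  define \<nu> where "\<nu> n = rescaled_tilt \<rho> (b n) (r n)" for n
  have \<nu>: "real_distribution (\<nu> n)" "gaussian_moments (\<nu> n)" for n
    unfolding \<nu>_def using rescaled_tilt_properties[OF G \<open>0 < r n\<close>] by auto
  have conv: "weak_conv_m \<nu> \<mu>" using assms(10) by (simp add: \<nu>_def[abs_def])
  obtain d where d: "d > 0" "(LINT x|\<mu>. min 2 ((d * x)\<^sup>2 / 2)) < 1 / 2"
    using truncated_second_moment_small[OF \<open>real_distribution \<mu>\<close>] .
  \<comment> \<open>The integrand is continuous and bounded by 2, so the strict inequality for
    \<open>\<mu>\<close> passes to all late \<open>\<nu> n\<close> with the same
    \<open>d\<close>.\<close>
  have "(\<lambda>n. LINT x|\<nu> n. min 2 ((d * x)\<^sup>2 / 2)) \<longlonglongrightarrow> (LINT x|\<mu>. min 2 ((d * x)\<^sup>2 / 2))"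
    by (rule weak_conv_imp_integral_bdd_continuous_conv[OF \<nu>(1) \<open>real_distribution \<mu>\<close> conv, where B = 2])
      (auto intro!: continuous_intros)
  then have "\<forall>\<^sub>F n in sequentially. (LINT x|\<nu> n. min 2 ((d * x)\<^sup>2 / 2)) < 1 / 2"
    using d(2) by (rule order_tendstoD(2))
  moreover have "\<forall>\<^sub>F n in sequentially. lam \<le> b n"
    using \<open>filterlim b at_top sequentially\<close> by (simp add: filterlim_at_top)
  ultimately have "\<forall>\<^sub>F n in sequentially. (LINT x|\<nu> n. min 2 ((d * x)\<^sup>2 / 2)) < 1 / 2 \<and> lam \<le> b n"
    by (rule eventually_conj)
  then obtain N where N: "\<And>n. n \<ge> N \<Longrightarrow> (LINT x|\<nu> n. min 2 ((d * x)\<^sup>2 / 2)) < 1 / 2 \<and> lam \<le> b n"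
    by (auto simp: eventually_sequentially)
  have "\<mu> \<in> \<X>"
  \<comment> \<open>Passing to the tail makes \<open>lam \<le> b n\<close> and the smallness
    condition hold for every index, as the lemma demands; the weak limit is unchanged.\<close>
  proof (rule weak_limit_in_X[where \<nu> = "\<lambda>n. \<nu> (n + N)"])
    show "only_real_zeros (\<nu> (n + N))" for n
      unfolding \<nu>_def using N[of "n + N"]
      by (intro rescaled_tilt_properties(3) G only_real_zeros_of_P[OF G lam] assms(8)) simp
    show "weak_conv_m (\<lambda>n. \<nu> (n + N)) \<mu>"
      using conv by (auto simp: weak_conv_m_def weak_conv_def intro: LIMSEQ_ignore_initial_segment)
    show "(LINT x|\<nu> (n + N). min 2 ((d * x)\<^sup>2 / 2)) \<le> 1 / 2" for n
      using N[of "n + N"] by simp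
  qed (use \<nu> \<open>real_distribution \<mu>\<close> d in auto)
  with \<open>\<mu> \<notin> \<X>\<close> show False by simp
qed

end
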